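(* In the v-set interpretation the Foundation principle is false: it is not the case that every inhabited set $x$ has an element $y\in x$ with $y\cap x=\emptyset$.
   Context: Work in Heyting arithmetic extended by unary predicates $\mathcal V$ ("v-set"), $\mathcal M$ ("Meaningful condition"), $\mathcal T$ ("True condition"). $\langle\cdot,\cdot\rangle$ is Cantor pairing with projections $(\cdot)_L,(\cdot)_R$; $en$ is Kleene application, $en\!\downarrow$ means it is defined. Write $\mathrm{cd}_x(n)=(xn)_R$, $\mathrm{el}_x(n)=(xn)_L$. $\Xi(f,g)$ is a fixed primitive recursive injective coding of pairs. Axioms: (V1) $\forall x\,[\forall n\,(xn\!\downarrow\wedge\mathcal M(\mathrm{cd}_x(n))\wedge(\mathcal T(\mathrm{cd}_x(n))\to\mathcal V(\mathrm{el}_x(n))))]\to\mathcal V(x)$; (V2) for every formula $\phi$: if the antecedent of (V1) with $\mathcal V$ replaced by $\phi$ implies $\phi(x)$ for all $x$, then $\forall x(\mathcal V(x)\to\phi(x))$; (X1) $\mathcal M(\Xi(f,g))\to(\mathcal T(\Xi(f,g))\leftrightarrow\forall n(fn\!\downarrow\wedge\mathcal T(fn)\to gn\!\downarrow\wedge\mathcal T(gn)))$; (X2) if $\forall n(fn\!\downarrow\to\mathcal M(fn))$ and $\forall n(fn\!\downarrow\wedge gn\!\downarrow\wedge\mathcal T(fn)\to\mathcal M(gn))$ then $\mathcal M(\Xi(f,g))$; ($\mathsf{ECT}_V$) $(\forall n(\phi(n)\to\exists m\,\psi(n,m)))\to\exists e\,\forall n(\phi(n)\to en\!\downarrow\wedge\psi(n,en))$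 for arbitrary $\psi$ and almost-negative $\phi$ (built from $\Sigma_1$ formulas and atoms $\mathcal V(t),\mathcal M(t),\mathcal T(t)$ by $\wedge,\to,\forall_{\mathbb N}$). Sets are interpreted as v-sets (numbers $x$ with $\mathcal V(x)$); $EL(x)=\{\mathrm{el}_x(n):\mathcal T(\mathrm{cd}_x(n))\}$. Set equality is extensional equality $\simeq$ of v-sets, characterized by $x\simeq y\iff(\forall a\in EL(x)\exists b\in EL(y)\,a\simeq b)\wedge(\forall b\in EL(y)\exists a\in EL(x)\,b\simeq a)$. Unbounded set quantifiers range over v-sets, bounded quantifiers range over $EL(x)$, and $x\in y$ means $\exists y'\in EL(y)\,x\simeq y'$. A set-theoretic statement is false in the v-set interpretation if the interpretation of its negation is provable in this system. *)

theory Defs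
  imports "HOL-Library.Nat_Bijection"
begin

section \<open>Primitive recursive function symbols\<close>

text \<open>
  Function symbols carry no arity: a symbol applied to a list of k arguments stands for a
  primitive recursive function of arity k. Recursion is on the first argument.
\<close>

datatype prfun = PZ | PS | PProj nat | PCn prfun "prfun list" | PPr prfun prfun

text \<open>The standard interpretation; the values at missing arguments are irrelevant.\<close>

fun psem :: "prfun \<Rightarrow> nat list \<Rightarrow> nat" where
  "psem PZ xs = 0"
| "psem PS xs = (case xs of [] \<Rightarrow> 1 | x # _ \<Rightarrow> Suc x)"
| "psem (PProj i) xs = (if i < length xs then xs ! i else 0)"
| "psem (PCn f gs) xs = psem f (map (\<lambda>g. psem g xs) gs)"
| "psem (PPr f g) xs = (case xs of [] \<Rightarrow> 0
     | n # ys \<Rightarrow> rec_nat (psem f ys) (\<lambda>k r. psem g (k # r # ys)) n)"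

definition pr_pred :: prfun where
  "pr_pred = PPr PZ (PProj 0)"

definition pr_add :: prfun where
  "pr_add = PPr (PProj 0) (PCn PS [PProj 1])"

text \<open>Truncated subtraction with the arguments exchanged: \<open>pr_rsub(y, x) = x - y\<close>.\<close>

definition pr_rsub :: prfun where
  "pr_rsub = PPr (PProj 0) (PCn pr_pred [PProj 1])"

text \<open>\<open>pr_ifz(t, x, y)\<close> is \<open>x\<close> if \<open>t = 0\<close> and \<open>y\<close> otherwise.\<close>

definition pr_ifz :: prfun where
  "pr_ifz = PPr (PProj 0) (PProj 3)"

definition pr_tri :: prfun where
  "pr_tri = PPr PZ (PCn pr_add [PProj 1, PCn PS [PProj 0]])"

text \<open>Cantor pairing \<open>\<langle>x, y\<rangle> = (x + y)(x + y + 1)/2 + x\<close>. For the projections,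
  \<open>pr_root(n)\<close> is the largest \<open>r\<close> with \<open>r(r + 1)/2 \<le> n\<close>.\<close>

definition pr_pair :: prfun where
  "pr_pair = PCn pr_add [PCn pr_tri [PCn pr_add [PProj 0, PProj 1]], PProj 0]"

definition pr_root :: prfun where
  "pr_root = PPr PZ (PCn pr_ifz
     [PCn pr_rsub [PCn PS [PProj 0], PCn pr_tri [PCn PS [PProj 1]]], PCn PS [PProj 1], PProj 1])"

definition pr_left :: prfun where
  "pr_left = PCn pr_rsub [PCn pr_tri [pr_root], PProj 0]"

definition pr_right :: prfun where
  "pr_right = PCn pr_rsub [pr_left, pr_root]"


section \<open>Kleene application\<close>

text \<open>
  Indices are codes of unary partial recursive functions, generated from the identity, zero,
  successor and the two projections by pairing, composition, primitive recursion and
  unbounded search; a code is \<open>\<langle>tag, data\<rangle>\<close>. The search code \<open>\<langle>8, a\<rangle>\<close> sends \<open>\<langle>u, m\<rangle>\<close> to the least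
  \<open>n \<ge> m\<close> such that \<open>a\<close> is defined on \<open>\<langle>u, i\<rangle>\<close> for all \<open>m \<le> i \<le> n\<close>, with value 0 at \<open>n\<close> only.
\<close>

abbreviation pe :: "nat \<Rightarrow> nat \<Rightarrow> nat" where
  "pe x y \<equiv> prod_encode (x, y)"

inductive kleene :: "nat \<Rightarrow> nat \<Rightarrow> nat \<Rightarrow> bool" where
  k_id:    "kleene (pe 0 i) v v"
| k_zero:  "kleene (pe 1 i) v 0"
| k_succ:  "kleene (pe 2 i) v (Suc v)"
| k_left:  "kleene (pe 3 i) (pe x y) x"
| k_right: "kleene (pe 4 i) (pe x y) y"
| k_pair:  "kleene a v x \<Longrightarrow> kleene b v y \<Longrightarrow> kleene (pe 5 (pe a b)) v (pe x y)"
| k_comp:  "kleene b v x \<Longrightarrow> kleene a x y \<Longrightarrow> kleene (pe 6 (pe a b)) v y"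
| k_rec0:  "kleene a u x \<Longrightarrow> kleene (pe 7 (pe a b)) (pe u 0) x"
| k_recS:  "kleene (pe 7 (pe a b)) (pe u n) x \<Longrightarrow> kleene b (pe u (pe n x)) y
            \<Longrightarrow> kleene (pe 7 (pe a b)) (pe u (Suc n)) y"
| k_mu0:   "kleene a (pe u m) 0 \<Longrightarrow> kleene (pe (8 + i) a) (pe u m) m"
| k_muS:   "kleene a (pe u m) (Suc w) \<Longrightarrow> kleene (pe (8 + i) a) (pe u (Suc m)) n
            \<Longrightarrow> kleene (pe (8 + i) a) (pe u m) n"

text \<open>
  The relation above is arithmetized by a stack machine. A configuration \<open>\<langle>p, \<langle>v, k\<rangle>\<rangle>\<close> means:
  run the code \<open>p\<close> on \<open>v\<close> with the stack \<open>k\<close> of pending frames, where \<open>0\<close> is the empty stack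
  and \<open>Suc \<langle>f, k\<rangle>\<close> is \<open>k\<close> with \<open>f\<close> pushed. The code \<open>p = 0\<close> returns \<open>v\<close> to the top frame.
\<close>

abbreviation qL :: "prfun \<Rightarrow> prfun" where "qL f \<equiv> PCn pr_left [f]"
abbreviation qR :: "prfun \<Rightarrow> prfun" where "qR f \<equiv> PCn pr_right [f]"
abbreviation qP :: "prfun \<Rightarrow> prfun \<Rightarrow> prfun" where "qP f g \<equiv> PCn pr_pair [f, g]"
abbreviation qS :: "prfun \<Rightarrow> prfun" where "qS f \<equiv> PCn PS [f]"
abbreviation qifz :: "prfun \<Rightarrow> prfun \<Rightarrow> prfun \<Rightarrow> prfun" where "qifz f g h \<equiv> PCn pr_ifz [f, g, h]"
abbreviation qconf :: "prfun \<Rightarrow> prfun \<Rightarrow> prfun \<Rightarrow> prfun" where "qconf p v k \<equiv> qP p (qP v k)"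
abbreviation qpush :: "prfun \<Rightarrow> prfun \<Rightarrow> prfun" where "qpush f k \<equiv> qS (qP f k)"

primrec qnum :: "nat \<Rightarrow> prfun" where
  "qnum 0 = PZ"
| "qnum (Suc n) = qS (qnum n)"

text \<open>\<open>qcase t [f0, \<dots>, fm]\<close> selects \<open>fi\<close> if \<open>t\<close> has the value \<open>i < m\<close>, and \<open>fm\<close> otherwise.\<close>

fun qcase :: "prfun \<Rightarrow> prfun list \<Rightarrow> prfun" where
  "qcase t [] = PZ"
| "qcase t [f] = f"
| "qcase t (f # g # fs) = qifz t f (qcase (PCn pr_pred [t]) (g # fs))"

definition pr_step :: prfun where
  "pr_step =
    (let p = qL (PProj 0); v = qL (qR (PProj 0)); k = qR (qR (PProj 0));
         a = qL (qR p); b = qR (qR p);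
         top = qL (PCn pr_pred [k]); rest = qR (PCn pr_pred [k]); d = qR top
     in qifz p
       (qifz k (qconf PZ v PZ)
         (qcase (qL top)
           [qconf d v rest,
            qconf (qL d) (qR d) (qpush (qP (qnum 2) v) rest),
            qconf PZ (qP d v) rest,
            qconf (qL d) (qP (qL (qR d)) (qP (qR (qR d)) v)) rest,
            qifz v (qconf PZ (qR (qR d)) rest)
                   (qconf (qL d) (qP (qL (qR d)) (qS (qR (qR d)))) rest)]))
       (qcase (qL p)
         [qconf PZ v k,
          qconf PZ PZ k,
          qconf PZ (qS v) k,
          qconf PZ (qL v) k,
          qconf PZ (qR v) k,
          qconf a v (qpush (qP (qnum 1) (qP b v)) k),
          qconf b v (qpush (qP (qnum 0) a) k),
          qifz (qR v) (qconf a (qL v) k)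
            (let v' = qP (qL v) (PCn pr_pred [qR v])
             in qconf p v' (qpush (qP (qnum 3) (qP b v')) k)),
          qconf (qR p) v (qpush (qP (qnum 4) (qP p v)) k)]))"

definition pr_run :: prfun where
  "pr_run = PPr (PProj 0) (PCn pr_step [PProj 1])"


section \<open>Formulas over the predicates V, M and T\<close>

text \<open>Variables are de Bruijn indices; substitution is simultaneous.\<close>

datatype tm = Var nat | Fn prfun "tm list"

primrec sbt :: "(nat \<Rightarrow> tm) \<Rightarrow> tm \<Rightarrow> tm" where
  "sbt \<sigma> (Var i) = \<sigma> i"
| "sbt \<sigma> (Fn f ts) = Fn f (map (sbt \<sigma>) ts)"

abbreviation lift :: "tm \<Rightarrow> tm" where
  "lift \<equiv> sbt (\<lambda>i. Var (Suc i))"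

datatype fm =
    Fls ("\<^bold>\<bottom>")
  | Eq tm tm (infix "\<^bold>=" 60)
  | PV tm
  | PM tm
  | PT tm
  | And fm fm (infixr "\<^bold>\<and>" 58)
  | Or fm fm (infixr "\<^bold>\<or>" 56)
  | Imp fm fm (infixr "\<^bold>\<longrightarrow>" 54)
  | All fm
  | Ex fm

definition up :: "(nat \<Rightarrow> tm) \<Rightarrow> nat \<Rightarrow> tm" where
  "up \<sigma> i = (case i of 0 \<Rightarrow> Var 0 | Suc j \<Rightarrow> lift (\<sigma> j))"

primrec sb :: "(nat \<Rightarrow> tm) \<Rightarrow> fm \<Rightarrow> fm" where
  "sb \<sigma> \<^bold>\<bottom> = \<^bold>\<bottom>"
| "sb \<sigma> (s \<^bold>= t) = (sbt \<sigma> s \<^bold>= sbt \<sigma> t)"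
| "sb \<sigma> (PV t) = PV (sbt \<sigma> t)"
| "sb \<sigma> (PM t) = PM (sbt \<sigma> t)"
| "sb \<sigma> (PT t) = PT (sbt \<sigma> t)"
| "sb \<sigma> (\<phi> \<^bold>\<and> \<psi>) = (sb \<sigma> \<phi> \<^bold>\<and> sb \<sigma> \<psi>)"
| "sb \<sigma> (\<phi> \<^bold>\<or> \<psi>) = (sb \<sigma> \<phi> \<^bold>\<or> sb \<sigma> \<psi>)"
| "sb \<sigma> (\<phi> \<^bold>\<longrightarrow> \<psi>) = (sb \<sigma> \<phi> \<^bold>\<longrightarrow> sb \<sigma> \<psi>)"
| "sb \<sigma> (All \<phi>) = All (sb (up \<sigma>) \<phi>)"
| "sb \<sigma> (Ex \<phi>) = Ex (sb (up \<sigma>) \<phi>)"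

abbreviation inst :: "tm \<Rightarrow> fm \<Rightarrow> fm" where
  "inst t \<equiv> sb (case_nat t Var)"

abbreviation liftf :: "fm \<Rightarrow> fm" where
  "liftf \<equiv> sb (\<lambda>i. Var (Suc i))"

abbreviation Neg :: "fm \<Rightarrow> fm" where
  "Neg \<phi> \<equiv> \<phi> \<^bold>\<longrightarrow> \<^bold>\<bottom>"

abbreviation Iff :: "fm \<Rightarrow> fm \<Rightarrow> fm" (infix "\<^bold>\<longleftrightarrow>" 52) where
  "\<phi> \<^bold>\<longleftrightarrow> \<psi> \<equiv> (\<phi> \<^bold>\<longrightarrow> \<psi>) \<^bold>\<and> (\<psi> \<^bold>\<longrightarrow> \<phi>)"

abbreviation zero :: tm where "zero \<equiv> Fn PZ []"
abbreviation succ :: "tm \<Rightarrow> tm" where "succ t \<equiv> Fn PS [t]"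
abbreviation pair :: "tm \<Rightarrow> tm \<Rightarrow> tm" where "pair s t \<equiv> Fn pr_pair [s, t]"
abbreviation lft :: "tm \<Rightarrow> tm" where "lft t \<equiv> Fn pr_left [t]"
abbreviation rgt :: "tm \<Rightarrow> tm" where "rgt t \<equiv> Fn pr_right [t]"

abbreviation less_fm :: "tm \<Rightarrow> tm \<Rightarrow> fm" (infix "\<^bold><" 60) where
  "s \<^bold>< t \<equiv> Fn pr_rsub [t, succ s] \<^bold>= zero"


section \<open>Intuitionistic natural deduction\<close>

inductive proves :: "fm set \<Rightarrow> fm set \<Rightarrow> fm \<Rightarrow> bool" for Ax :: "fm set" where
  axm:   "\<phi> \<in> Ax \<Longrightarrow> proves Ax \<Gamma> \<phi>"
| hyp:   "\<phi> \<in> \<Gamma> \<Longrightarrow> proves Ax \<Gamma> \<phi>"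
| FlsE:  "proves Ax \<Gamma> \<^bold>\<bottom> \<Longrightarrow> proves Ax \<Gamma> \<phi>"
| AndI:  "proves Ax \<Gamma> \<phi> \<Longrightarrow> proves Ax \<Gamma> \<psi> \<Longrightarrow> proves Ax \<Gamma> (\<phi> \<^bold>\<and> \<psi>)"
| AndE1: "proves Ax \<Gamma> (\<phi> \<^bold>\<and> \<psi>) \<Longrightarrow> proves Ax \<Gamma> \<phi>"
| AndE2: "proves Ax \<Gamma> (\<phi> \<^bold>\<and> \<psi>) \<Longrightarrow> proves Ax \<Gamma> \<psi>"
| OrI1:  "proves Ax \<Gamma> \<phi> \<Longrightarrow> proves Ax \<Gamma> (\<phi> \<^bold>\<or> \<psi>)"
| OrI2:  "proves Ax \<Gamma> \<psi> \<Longrightarrow> proves Ax \<Gamma> (\<phi> \<^bold>\<or> \<psi>)"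
| OrE:   "proves Ax \<Gamma> (\<phi> \<^bold>\<or> \<psi>) \<Longrightarrow> proves Ax (insert \<phi> \<Gamma>) \<chi> \<Longrightarrow> proves Ax (insert \<psi> \<Gamma>) \<chi>
          \<Longrightarrow> proves Ax \<Gamma> \<chi>"
| ImpI:  "proves Ax (insert \<phi> \<Gamma>) \<psi> \<Longrightarrow> proves Ax \<Gamma> (\<phi> \<^bold>\<longrightarrow> \<psi>)"
| ImpE:  "proves Ax \<Gamma> (\<phi> \<^bold>\<longrightarrow> \<psi>) \<Longrightarrow> proves Ax \<Gamma> \<phi> \<Longrightarrow> proves Ax \<Gamma> \<psi>"
| AllI:  "proves Ax (liftf ` \<Gamma>) \<phi> \<Longrightarrow> proves Ax \<Gamma> (All \<phi>)"
| AllE:  "proves Ax \<Gamma> (All \<phi>) \<Longrightarrow> proves Ax \<Gamma> (inst t \<phi>)"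
| ExI:   "proves Ax \<Gamma> (inst t \<phi>) \<Longrightarrow> proves Ax \<Gamma> (Ex \<phi>)"
| ExE:   "proves Ax \<Gamma> (Ex \<phi>) \<Longrightarrow> proves Ax (insert \<phi> (liftf ` \<Gamma>)) (liftf \<chi>) \<Longrightarrow> proves Ax \<Gamma> \<chi>"


section \<open>The axioms\<close>

text \<open>
  Free variables in axioms are read universally. The schemes range over all formulas,
  including those containing V, M and T.
\<close>

inductive_set HA :: "fm set" where
  eq_refl:  "t \<^bold>= t \<in> HA"
| eq_subst: "s \<^bold>= t \<^bold>\<longrightarrow> inst s \<phi> \<^bold>\<longrightarrow> inst t \<phi> \<in> HA"
| succ_nz:  "Neg (succ t \<^bold>= zero) \<in> HA"
| succ_inj: "succ s \<^bold>= succ t \<^bold>\<longrightarrow> s \<^bold>= t \<in> HA"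
| pr_Z:     "Fn PZ ts \<^bold>= zero \<in> HA"
| pr_Proj:  "i < length ts \<Longrightarrow> Fn (PProj i) ts \<^bold>= ts ! i \<in> HA"
| pr_Cn:    "Fn (PCn f gs) ts \<^bold>= Fn f (map (\<lambda>g. Fn g ts) gs) \<in> HA"
| pr_Pr0:   "Fn (PPr f g) (zero # ts) \<^bold>= Fn f ts \<in> HA"
| pr_PrS:   "Fn (PPr f g) (succ t # ts) \<^bold>= Fn g (t # Fn (PPr f g) (t # ts) # ts) \<in> HA"
| ind:      "inst zero \<phi> \<^bold>\<and> All (\<phi> \<^bold>\<longrightarrow> sb (case_nat (succ (Var 0)) (\<lambda>i. Var (Suc i))) \<phi>)
             \<^bold>\<longrightarrow> All \<phi> \<in> HA"

text \<open>
  \<open>app s t u\<close> says that the Kleene application of \<open>s\<close> to \<open>t\<close> is defined with value \<open>u\<close>.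
  A statement about the partial term \<open>st\<close> includes that \<open>st\<close> is defined: \<open>\<phi>(st)\<close> is
  \<open>app_sat s t \<phi>\<close>, where \<open>Var 0\<close> is the place of the value in \<open>\<phi>\<close>.
\<close>

definition app :: "tm \<Rightarrow> tm \<Rightarrow> tm \<Rightarrow> fm" where
  "app s t u = Ex (Fn pr_run [Var 0, pair (lift s) (pair (lift t) zero)]
                   \<^bold>= pair zero (pair (lift u) zero))"

definition app_sat :: "tm \<Rightarrow> tm \<Rightarrow> fm \<Rightarrow> fm" where
  "app_sat s t \<phi> = Ex (app (lift s) (lift t) (Var 0) \<^bold>\<and> \<phi>)"

definition defd :: "tm \<Rightarrow> tm \<Rightarrow> fm" where
  "defd s t = Ex (app (lift s) (lift t) (Var 0))"

text \<open>The antecedent of the closure axiom for v-sets, at \<open>x = Var 0\<close>, with \<open>\<phi>\<close> (argument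
  \<open>Var 0\<close>) in place of V. Inside, \<open>Var 0\<close> is \<open>xn\<close>, \<open>Var 1\<close> is \<open>n\<close> and \<open>Var 2\<close> is \<open>x\<close>.\<close>

definition vclosed :: "fm \<Rightarrow> fm" where
  "vclosed \<phi> = All (app_sat (Var 1) (Var 0)
     (PM (rgt (Var 0)) \<^bold>\<and>
      (PT (rgt (Var 0)) \<^bold>\<longrightarrow> sb (case_nat (lft (Var 0)) (\<lambda>i. Var (i + 3))) \<phi>)))"

inductive delta0 :: "fm \<Rightarrow> bool" where
  "delta0 \<^bold>\<bottom>"
| "delta0 (s \<^bold>= t)"
| "delta0 \<phi> \<Longrightarrow> delta0 \<psi> \<Longrightarrow> delta0 (\<phi> \<^bold>\<and> \<psi>)"
| "delta0 \<phi> \<Longrightarrow> delta0 \<psi> \<Longrightarrow> delta0 (\<phi> \<^bold>\<or> \<psi>)"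
| "delta0 \<phi> \<Longrightarrow> delta0 \<psi> \<Longrightarrow> delta0 (\<phi> \<^bold>\<longrightarrow> \<psi>)"
| "delta0 \<phi> \<Longrightarrow> delta0 (All (Var 0 \<^bold>< lift t \<^bold>\<longrightarrow> \<phi>))"
| "delta0 \<phi> \<Longrightarrow> delta0 (Ex (Var 0 \<^bold>< lift t \<^bold>\<and> \<phi>))"

inductive sigma1 :: "fm \<Rightarrow> bool" where
  "delta0 \<phi> \<Longrightarrow> sigma1 \<phi>"
| "sigma1 \<phi> \<Longrightarrow> sigma1 (Ex \<phi>)"

inductive almost_negative :: "fm \<Rightarrow> bool" where
  "sigma1 \<phi> \<Longrightarrow> almost_negative \<phi>"
| "almost_negative (PV t)"
| "almost_negative (PM t)"
| "almost_negative (PT t)"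
| "almost_negative \<phi> \<Longrightarrow> almost_negative \<psi> \<Longrightarrow> almost_negative (\<phi> \<^bold>\<and> \<psi>)"
| "almost_negative \<phi> \<Longrightarrow> almost_negative \<psi> \<Longrightarrow> almost_negative (\<phi> \<^bold>\<longrightarrow> \<psi>)"
| "almost_negative \<phi> \<Longrightarrow> almost_negative (All \<phi>)"

text \<open>In \<open>X1\<close> and \<open>X2\<close>, \<open>f\<close> and \<open>g\<close> are arbitrary terms. In \<open>ECT\<close>, \<open>\<phi>\<close> has \<open>n = Var 0\<close>, and
  \<open>\<psi>\<close> has \<open>m = Var 0\<close> and \<open>n = Var 1\<close>; the renamings make room for \<open>e\<close>.\<close>

inductive_set VMT :: "prfun \<Rightarrow> fm set" for \<xi> :: prfun where
  arith: "\<phi> \<in> HA \<Longrightarrow> \<phi> \<in> VMT \<xi>"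
| V1: "All (vclosed (PV (Var 0)) \<^bold>\<longrightarrow> PV (Var 0)) \<in> VMT \<xi>"
| V2: "All (vclosed \<phi> \<^bold>\<longrightarrow> \<phi>) \<^bold>\<longrightarrow> All (PV (Var 0) \<^bold>\<longrightarrow> \<phi>) \<in> VMT \<xi>"
| X1: "PM (Fn \<xi> [f, g]) \<^bold>\<longrightarrow>
       (PT (Fn \<xi> [f, g]) \<^bold>\<longleftrightarrow>
        All (app_sat (lift f) (Var 0) (PT (Var 0)) \<^bold>\<longrightarrow> app_sat (lift g) (Var 0) (PT (Var 0))))
       \<in> VMT \<xi>"
| X2: "All (defd (lift f) (Var 0) \<^bold>\<longrightarrow> app_sat (lift f) (Var 0) (PM (Var 0))) \<^bold>\<and>
       All (defd (lift f) (Var 0) \<^bold>\<and> defd (lift g) (Var 0) \<^bold>\<and> app_sat (lift f) (Var 0) (PT (Var 0))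
            \<^bold>\<longrightarrow> app_sat (lift g) (Var 0) (PM (Var 0)))
       \<^bold>\<longrightarrow> PM (Fn \<xi> [f, g]) \<in> VMT \<xi>"
| ECT: "almost_negative \<phi> \<Longrightarrow>
       All (\<phi> \<^bold>\<longrightarrow> Ex \<psi>) \<^bold>\<longrightarrow>
       Ex (All (sb (\<lambda>i. Var (if i < 1 then i else Suc i)) \<phi> \<^bold>\<longrightarrow>
                app_sat (Var 1) (Var 0) (sb (\<lambda>i. Var (if i < 2 then i else Suc i)) \<psi>)))
       \<in> VMT \<xi>"


section \<open>The v-set interpretation\<close>

text \<open>The formula \<open>s \<in> EL(t)\<close>; inside, \<open>Var 0\<close> is \<open>tn\<close> and \<open>Var 1\<close> is \<open>n\<close>.\<close>

definition inEL :: "tm \<Rightarrow> tm \<Rightarrow> fm" where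
  "inEL s t = Ex (app_sat (lift t) (Var 0)
     (PT (rgt (Var 0)) \<^bold>\<and> lift (lift s) \<^bold>= lft (Var 0)))"

text \<open>A binary relation between numbers is given by a formula with the free variables \<open>Var 0\<close> and
  \<open>Var 1\<close>; any further free variable is set to zero.\<close>

definition rel2 :: "fm \<Rightarrow> tm \<Rightarrow> tm \<Rightarrow> fm" where
  "rel2 E s t = sb (case_nat s (case_nat t (\<lambda>_. zero))) E"

text \<open>The characterization of extensional equality of v-sets (\<open>x = Var 1\<close>, \<open>y = Var 0\<close>). By
  induction over V it determines \<open>E\<close> up to provable equivalence on v-sets.\<close>

definition ext_equality :: "fm \<Rightarrow> fm" where
  "ext_equality E = All (All (PV (Var 1) \<^bold>\<and> PV (Var 0) \<^bold>\<longrightarrow>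
     (rel2 E (Var 1) (Var 0) \<^bold>\<longleftrightarrow>
       All (inEL (Var 0) (Var 2) \<^bold>\<longrightarrow> Ex (inEL (Var 0) (Var 2) \<^bold>\<and> rel2 E (Var 1) (Var 0))) \<^bold>\<and>
       All (inEL (Var 0) (Var 1) \<^bold>\<longrightarrow> Ex (inEL (Var 0) (Var 3) \<^bold>\<and> rel2 E (Var 1) (Var 0))))))"

text \<open>Formulas of set theory, with de Bruijn indices. In \<open>SBAll i \<phi>\<close> and \<open>SBEx i \<phi>\<close> the bound \<open>i\<close>
  is counted outside of the quantifier.\<close>

datatype sfm = SFls | SEq nat nat | SMem nat nat | SAnd sfm sfm | SOr sfm sfm | SImp sfm sfm
  | SAll sfm | SEx sfm | SBAll nat sfm | SBEx nat sfm

abbreviation SNeg :: "sfm \<Rightarrow> sfm" where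
  "SNeg \<phi> \<equiv> SImp \<phi> SFls"

primrec interp :: "fm \<Rightarrow> sfm \<Rightarrow> fm" where
  "interp E SFls = \<^bold>\<bottom>"
| "interp E (SEq i j) = rel2 E (Var i) (Var j)"
| "interp E (SMem i j) = Ex (inEL (Var 0) (Var (Suc j)) \<^bold>\<and> rel2 E (Var (Suc i)) (Var 0))"
| "interp E (SAnd \<phi> \<psi>) = (interp E \<phi> \<^bold>\<and> interp E \<psi>)"
| "interp E (SOr \<phi> \<psi>) = (interp E \<phi> \<^bold>\<or> interp E \<psi>)"
| "interp E (SImp \<phi> \<psi>) = (interp E \<phi> \<^bold>\<longrightarrow> interp E \<psi>)"
| "interp E (SAll \<phi>) = All (PV (Var 0) \<^bold>\<longrightarrow> interp E \<phi>)"
| "interp E (SEx \<phi>) = Ex (PV (Var 0) \<^bold>\<and> interp E \<phi>)"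
| "interp E (SBAll i \<phi>) = All (inEL (Var 0) (Var (Suc i)) \<^bold>\<longrightarrow> interp E \<phi>)"
| "interp E (SBEx i \<phi>) = Ex (inEL (Var 0) (Var (Suc i)) \<^bold>\<and> interp E \<phi>)"

definition false_in_vsets :: "prfun \<Rightarrow> fm \<Rightarrow> sfm \<Rightarrow> bool" where
  "false_in_vsets \<xi> E \<phi> \<longleftrightarrow> proves (VMT \<xi>) {} (interp E (SNeg \<phi>))"

definition inhabited :: "nat \<Rightarrow> sfm" where
  "inhabited i = SEx (SMem 0 (Suc i))"

definition disjoint_sets :: "nat \<Rightarrow> nat \<Rightarrow> sfm" where
  "disjoint_sets i j = SAll (SNeg (SAnd (SMem 0 (Suc i)) (SMem 0 (Suc j))))"

definition foundation :: sfm where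
  "foundation = SAll (SImp (inhabited 0) (SBEx 0 (disjoint_sets 0 1)))"


section \<open>The arithmetization computes Kleene application\<close>

lemma psem_pred [simp]: "psem pr_pred [x] = x - 1"
  by (cases x) (auto simp: pr_pred_def)

lemma psem_add [simp]: "psem pr_add [x, y] = x + y"
  by (induction x) (auto simp: pr_add_def)

lemma psem_rsub [simp]: "psem pr_rsub [y, x] = x - y"
  by (induction y) (auto simp: pr_rsub_def)

lemma psem_ifz [simp]: "psem pr_ifz [t, x, y] = (if t = 0 then x else y)"
  by (cases t) (auto simp: pr_ifz_def)

lemma psem_tri [simp]: "psem pr_tri [x] = triangle x"
  by (induction x) (auto simp: pr_tri_def)

lemma psem_pair [simp]: "psem pr_pair [x, y] = pe x y"
  by (simp add: pr_pair_def prod_encode_def)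

lemma triangle_mono: "m \<le> n \<Longrightarrow> triangle m \<le> triangle n"
  by (induction rule: dec_induct) auto

lemma psem_root_Suc: "psem pr_root [Suc n] =
   (if triangle (Suc (psem pr_root [n])) \<le> Suc n then Suc (psem pr_root [n]) else psem pr_root [n])"
  by (auto simp: pr_root_def)

lemma psem_root_bounds:
  "triangle (psem pr_root [n]) \<le> n \<and> n < triangle (Suc (psem pr_root [n]))"
proof (induction n)
  case 0
  then show ?case by (simp add: pr_root_def)
next
  case (Suc n)
  then show ?case unfolding psem_root_Suc by auto
qed

lemma psem_root [simp]: "psem pr_root [pe x y] = x + y"
proof -
  let ?r = "psem pr_root [pe x y]"
  have *: "triangle (x + y) \<le> pe x y" "pe x y < triangle (Suc (x + y))"
    by (auto simp: prod_encode_def)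
  have "\<not> Suc ?r \<le> x + y"
    using triangle_mono[of "Suc ?r" "x + y"] psem_root_bounds[of "pe x y"] * by linarith
  moreover have "\<not> Suc (x + y) \<le> ?r"
    using triangle_mono[of "Suc (x + y)" ?r] psem_root_bounds[of "pe x y"] * by linarith
  ultimately show ?thesis by linarith
qed

lemma psem_left [simp]: "psem pr_left [n] = fst (prod_decode n)"
proof -
  obtain x y where n: "n = pe x y" by (metis prod_decode_inverse surj_pair)
  have "psem pr_left [pe x y] = x"
    by (simp add: pr_left_def) (simp add: prod_encode_def)
  then show ?thesis by (simp add: n)
qed

lemma psem_right [simp]: "psem pr_right [n] = snd (prod_decode n)"
proof -
  obtain x y where n: "n = pe x y" by (metis prod_decode_inverse surj_pair)
  have "psem pr_right [pe x y] = y" by (simp add: pr_right_def)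
  then show ?thesis by (simp add: n)
qed

definition kstep :: "nat \<Rightarrow> nat" where
  "kstep c = psem pr_step [c]"

abbreviation conf :: "nat \<Rightarrow> nat \<Rightarrow> nat \<Rightarrow> nat" where
  "conf p v k \<equiv> pe p (pe v k)"

lemma psem_run: "psem pr_run [z, c] = (kstep ^^ z) c"
  by (induction z) (auto simp: pr_run_def kstep_def)

lemma pe_0: "pe 0 0 = 0"
  by (simp add: prod_encode_def)

lemma pe_eq_0: "pe a b = 0 \<longleftrightarrow> a = 0 \<and> b = 0"
  by (metis pe_0 prod_encode_eq prod.inject)

lemma kstep_simps:
  "kstep (conf 0 v 0) = conf 0 v 0"
  "kstep (conf 0 v (Suc (pe (pe 0 a) k))) = conf a v k"
  "kstep (conf 0 v (Suc (pe (pe 1 (pe b u)) k))) = conf b u (Suc (pe (pe 2 v) k))"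
  "kstep (conf 0 v (Suc (pe (pe 2 x) k))) = conf 0 (pe x v) k"
  "kstep (conf 0 v (Suc (pe (pe 3 (pe b (pe u n))) k))) = conf b (pe u (pe n v)) k"
  "kstep (conf 0 0 (Suc (pe (pe 4 (pe p (pe u m))) k))) = conf 0 m k"
  "kstep (conf 0 (Suc w) (Suc (pe (pe 4 (pe p (pe u m))) k))) = conf p (pe u (Suc m)) k"
  "i > 0 \<Longrightarrow> kstep (conf (pe 0 i) v k) = conf 0 v k"
  "kstep (conf (pe 1 i) v k) = conf 0 0 k"
  "kstep (conf (pe 2 i) v k) = conf 0 (Suc v) k"
  "kstep (conf (pe 3 i) (pe x y) k) = conf 0 x k"
  "kstep (conf (pe 4 i) (pe x y) k) = conf 0 y k"
  "kstep (conf (pe 5 (pe a b)) v k) = conf a v (Suc (pe (pe 1 (pe b v)) k))"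
  "kstep (conf (pe 6 (pe a b)) v k) = conf b v (Suc (pe (pe 0 a) k))"
  "kstep (conf (pe 7 (pe a b)) (pe u 0) k) = conf a u k"
  "kstep (conf (pe 7 (pe a b)) (pe u (Suc n)) k) =
     conf (pe 7 (pe a b)) (pe u n) (Suc (pe (pe 3 (pe b (pe u n))) k))"
  "kstep (conf (pe (8 + i) a) v k) = conf a v (Suc (pe (pe 4 (pe (pe (8 + i) a) v)) k))"
  by (simp_all add: kstep_def pr_step_def Let_def numeral_eq_Suc pe_eq_0)

lemma kstep_trans:
  "\<exists>z. (kstep ^^ z) c = d \<Longrightarrow> \<exists>z. (kstep ^^ z) d = e \<Longrightarrow> \<exists>z. (kstep ^^ z) c = e"
  by (metis funpow_add comp_apply)

lemma kstep_Suc: "\<exists>z. (kstep ^^ z) (kstep c) = e \<Longrightarrow> \<exists>z. (kstep ^^ z) c = e"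
  by (metis funpow_swap1 funpow.simps(2) comp_apply)

lemma kleene_run: "kleene p v w \<Longrightarrow> \<exists>z. (kstep ^^ z) (conf p v k) = conf 0 w k"
proof (induction arbitrary: k rule: kleene.induct)
  case (k_id i v)
  show ?case
  proof (cases "i = 0")
    case True
    then show ?thesis by (intro exI[of _ 0]) (simp add: pe_0)
  next
    case False
    then show ?thesis by (intro exI[of _ 1]) (simp add: kstep_simps)
  qed
next
  case (k_zero i v)
  show ?case by (intro exI[of _ 1]) (simp add: kstep_simps(9)[simplified])
next
  case (k_succ i v)
  show ?case by (intro exI[of _ 1]) (simp add: kstep_simps)
next
  case (k_left i x y)
  show ?case by (intro exI[of _ 1]) (simp add: kstep_simps)
next
  case (k_right i x y)
  show ?case by (intro exI[of _ 1]) (simp add: kstep_simps)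
next
  case (k_pair a v x b y)
  show ?case
    by (rule kstep_Suc, subst kstep_simps, rule kstep_trans[OF k_pair.IH(1)], rule kstep_Suc,
        subst kstep_simps, rule kstep_trans[OF k_pair.IH(2)], rule exI[of _ 1])
       (simp add: kstep_simps)
next
  case (k_comp b v x a y)
  show ?case
    by (rule kstep_Suc, subst kstep_simps, rule kstep_trans[OF k_comp.IH(1)], rule kstep_Suc,
        subst kstep_simps, rule k_comp.IH(2))
next
  case (k_rec0 a u x b)
  show ?case by (rule kstep_Suc, subst kstep_simps, rule k_rec0.IH)
next
  case (k_recS a b u n x y)
  show ?case
    by (rule kstep_Suc, subst kstep_simps, rule kstep_trans[OF k_recS.IH(1)], rule kstep_Suc,
        subst kstep_simps, rule k_recS.IH(2))
next
  case (k_mu0 a u m i)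
  show ?case
    by (rule kstep_Suc, subst kstep_simps, rule kstep_trans[OF k_mu0.IH], rule exI[of _ 1])
       (simp add: kstep_simps)
next
  case (k_muS a u m w i n)
  show ?case
    by (rule kstep_Suc, subst kstep_simps, rule kstep_trans[OF k_muS.IH(1)], rule kstep_Suc,
        subst kstep_simps, rule k_muS.IH(2))
qed

lemma pe_cases: obtains x y where "n = pe x y"
  by (metis prod_decode_inverse surj_pair)

lemma run_kleene:
  "(kstep ^^ z) (conf p v k) = conf 0 m 0 \<Longrightarrow>
   \<exists>w z'. kleene p v w \<and> z' \<le> z \<and> (kstep ^^ z') (conf 0 w k) = conf 0 m 0"
proof (induction z arbitrary: p v k rule: less_induct)
  case (less z)
  obtain t d where p: "p = pe t d" by (rule pe_cases)
  obtain a b where d: "d = pe a b" by (rule pe_cases)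
  obtain x y where v: "v = pe x y" by (rule pe_cases)
  show ?case
  proof (cases "p = 0")
    case True
    then show ?thesis using less.prems k_id[of 0 v] by (auto simp: pe_0)
  next
    case False
    have "z \<noteq> 0"
    proof
      assume "z = 0"
      then show False using less.prems False by (auto simp: prod_encode_eq)
    qed
    then obtain z0 where z: "z = Suc z0" using not0_implies_Suc by blast
    have run: "(kstep ^^ z0) (kstep (conf p v k)) = conf 0 m 0"
      using less.prems by (simp add: z funpow_swap1)
    have step: "\<exists>w z'. kleene q u w \<and> z' \<le> z1 \<and> (kstep ^^ z') (conf 0 w k') = conf 0 m 0"
      if "(kstep ^^ z1) (conf q u k') = conf 0 m 0" "z1 \<le> z0" for q u k' z1
      using less.IH[of z1 q u k'] that z by simp
    have ret: "\<exists>z1. z' = Suc z1 \<and> (kstep ^^ z1) (kstep (conf 0 w (Suc k'))) = conf 0 m 0"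
      if "(kstep ^^ z') (conf 0 w (Suc k')) = conf 0 m 0" for w k' z'
    proof (cases z')
      case 0
      then show ?thesis using that by (simp add: prod_encode_eq)
    next
      case (Suc z1)
      then show ?thesis using that by (simp add: funpow_swap1)
    qed
    have basic: ?thesis if "kleene p v w" "kstep (conf p v k) = conf 0 w k" for w
    proof -
      have "z0 \<le> z" using z by simp
      then show ?thesis using run that by metis
    qed
    have "t < 8 \<or> (\<exists>i. t = 8 + i)" by presburger
    then consider "t = 0" | "t = 1" | "t = 2" | "t = 3" | "t = 4" | "t = 5" | "t = 6" | "t = 7"
      | i where "t = 8 + i"
      by (auto simp: less_Suc_eq numeral_eq_Suc)
    then show ?thesis
    proof cases
      case 1
      then have "d > 0" using False p by (auto simp: pe_eq_0)
      then show ?thesis using basic[of v] by (simp add: p 1 kstep_simps k_id)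
    next
      case 2
      then show ?thesis by (metis basic k_zero kstep_simps(9) p)
    next
      case 3
      then show ?thesis by (metis basic k_succ kstep_simps(10) p)
    next
      case 4
      then show ?thesis by (metis basic k_left kstep_simps(11) p v)
    next
      case 5
      then show ?thesis by (metis basic k_right kstep_simps(12) p v)
    next
      case 6
      from run have "(kstep ^^ z0) (conf a v (Suc (pe (pe 1 (pe b v)) k))) = conf 0 m 0"
        by (simp only: p d 6 kstep_simps)
      from step[OF this] obtain w1 z1 where 1: "kleene a v w1" "z1 \<le> z0"
        "(kstep ^^ z1) (conf 0 w1 (Suc (pe (pe 1 (pe b v)) k))) = conf 0 m 0" by auto
      from ret[OF 1(3)] obtain z2 where 2: "z1 = Suc z2"
        "(kstep ^^ z2) (conf b v (Suc (pe (pe 2 w1) k))) = conf 0 m 0"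
        by (auto simp only: kstep_simps)
      have "z2 \<le> z0" using 1 2 by simp
      from step[OF 2(2) this] obtain w3 z3 where 3: "kleene b v w3" "z3 \<le> z2"
        "(kstep ^^ z3) (conf 0 w3 (Suc (pe (pe 2 w1) k))) = conf 0 m 0" by auto
      from ret[OF 3(3)] obtain z4 where 4: "z3 = Suc z4"
        "(kstep ^^ z4) (conf 0 (pe w1 w3) k) = conf 0 m 0"
        by (auto simp only: kstep_simps)
      have "z4 \<le> z" using 1 2 3 4 z by simp
      then show ?thesis using k_pair[OF 1(1) 3(1)] 4(2) by (auto simp only: p d 6)
    next
      case 7
      from run have "(kstep ^^ z0) (conf b v (Suc (pe (pe 0 a) k))) = conf 0 m 0"
        by (simp only: p d 7 kstep_simps)
      from step[OF this] obtain w1 z1 where 1: "kleene b v w1" "z1 \<le> z0"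
        "(kstep ^^ z1) (conf 0 w1 (Suc (pe (pe 0 a) k))) = conf 0 m 0" by auto
      from ret[OF 1(3)] obtain z2 where 2: "z1 = Suc z2"
        "(kstep ^^ z2) (conf a w1 k) = conf 0 m 0"
        by (auto simp only: kstep_simps)
      have "z2 \<le> z0" using 1 2 by simp
      from step[OF 2(2) this] obtain w3 z3 where 3: "kleene a w1 w3" "z3 \<le> z2"
        "(kstep ^^ z3) (conf 0 w3 k) = conf 0 m 0" by auto
      have "z3 \<le> z" using 1 2 3 z by simp
      then show ?thesis using k_comp[OF 1(1) 3(1)] 3(3) by (auto simp only: p d 7)
    next
      case 8
      show ?thesis
      proof (cases y)
        case 0
        from run have "(kstep ^^ z0) (conf a x k) = conf 0 m 0"
          by (simp only: p d 8 v 0 kstep_simps)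
        from step[OF this] obtain w1 z1 where 1: "kleene a x w1" "z1 \<le> z0"
          "(kstep ^^ z1) (conf 0 w1 k) = conf 0 m 0" by auto
        have "z1 \<le> z" using 1 z by simp
        then show ?thesis using k_rec0[OF 1(1)] 1(3) by (auto simp only: p d 8 v 0)
      next
        case (Suc n)
        from run have "(kstep ^^ z0) (conf p (pe x n) (Suc (pe (pe 3 (pe b (pe x n))) k)))
            = conf 0 m 0"
          by (simp only: p d 8 v Suc kstep_simps)
        from step[OF this] obtain w1 z1 where 1: "kleene p (pe x n) w1" "z1 \<le> z0"
          "(kstep ^^ z1) (conf 0 w1 (Suc (pe (pe 3 (pe b (pe x n))) k))) = conf 0 m 0" by auto
        from ret[OF 1(3)] obtain z2 where 2: "z1 = Suc z2"
          "(kstep ^^ z2) (conf b (pe x (pe n w1)) k) = conf 0 m 0"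
          by (auto simp only: kstep_simps)
        have "z2 \<le> z0" using 1 2 by simp
        from step[OF 2(2) this] obtain w3 z3 where 3: "kleene b (pe x (pe n w1)) w3" "z3 \<le> z2"
          "(kstep ^^ z3) (conf 0 w3 k) = conf 0 m 0" by auto
        have "z3 \<le> z" using 1 2 3 z by simp
        then show ?thesis using k_recS[OF 1(1)[unfolded p d 8] 3(1)] 3(3)
          by (auto simp only: p d 8 v Suc)
      qed
    next
      case (9 i)
      from run have "(kstep ^^ z0) (conf d v (Suc (pe (pe 4 (pe p v)) k))) = conf 0 m 0"
        by (simp only: p 9 kstep_simps)
      from step[OF this] obtain w1 z1 where 1: "kleene d v w1" "z1 \<le> z0"
        "(kstep ^^ z1) (conf 0 w1 (Suc (pe (pe 4 (pe p v)) k))) = conf 0 m 0" by auto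
      from ret[OF 1(3)] obtain z2 where 2: "z1 = Suc z2"
        "(kstep ^^ z2) (kstep (conf 0 w1 (Suc (pe (pe 4 (pe p v)) k)))) = conf 0 m 0"
        by auto
      show ?thesis
      proof (cases w1)
        case 0
        have 3: "(kstep ^^ z2) (conf 0 y k) = conf 0 m 0"
          using 2(2) by (simp only: 0 v kstep_simps)
        have "z2 \<le> z" using 1 2 z by simp
        then show ?thesis using k_mu0[OF 1(1)[unfolded v 0], of i] 3 by (auto simp only: p 9 v)
      next
        case (Suc w)
        have "(kstep ^^ z2) (conf p (pe x (Suc y)) k) = conf 0 m 0"
          using 2(2) by (simp only: Suc v kstep_simps)
        moreover have "z2 \<le> z0" using 1 2 by simp
        ultimately obtain w3 z3 where 3: "kleene p (pe x (Suc y)) w3" "z3 \<le> z2"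
          "(kstep ^^ z3) (conf 0 w3 k) = conf 0 m 0" using step by blast
        have "z3 \<le> z" using 1 2 3 z by simp
        then show ?thesis using k_muS[OF 1(1)[unfolded v Suc] 3(1)[unfolded p 9]] 3(3)
          by (auto simp only: p 9 v)
      qed
    qed
  qed
qed

theorem kleene_arithmetized:
  "kleene e n m \<longleftrightarrow>
   (\<exists>z. psem pr_run [z, psem pr_pair [e, psem pr_pair [n, 0]]]
        = psem pr_pair [0, psem pr_pair [m, 0]])"
proof -
  have "(kstep ^^ z) (conf 0 w 0) = conf 0 w 0" for w z
    by (induction z) (simp_all add: kstep_simps)
  then show ?thesis
    using kleene_run[of e n m 0] run_kleene[of _ e n 0 m]
    by (auto simp: psem_run prod_encode_eq simp del: funpow.simps)
qed

end

theory Submission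
  imports Defs
begin

text \<open>
  For a condition \<open>p\<close>, Foundation applied to the v-set \<open>{\<emptyset> | p} \<union> {{\<emptyset>}}\<close> yields
  \<open>T(p) \<or> \<not>T(p)\<close>. A code that diverges everywhere gives, through \<open>\<Xi>\<close>, a true and a false condition, and
  from these, for every \<open>n\<close>, a condition that is true iff no computation of \<open>nn\<close> ends with 0. So Foundation
  decides whether \<open>nn = 0\<close> is impossible, and as \<open>nn\<close> has at most one value this produces for every
  \<open>n\<close> some \<open>m \<in> {0, 1}\<close> with \<open>\<not>(nn = m)\<close>. \<open>ECT\<close> turns this into a code \<open>e\<close> with
  \<open>en\<close> defined and different from \<open>nn\<close> for all \<open>n\<close>, which is absurd at \<open>n = e\<close>. All other
  codes in the argument are total and come from \<open>ECT\<close>, too.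
\<close>

section \<open>Substitution\<close>

text \<open>Meaningful conditions are introduced by \<open>X2\<close>, which asks that the values of
  f be meaningful already; an f without values is what starts the construction. So the divergence of
  one concrete code, and the uniqueness of values of Kleene application, have to be derived inside
  the formal theory. This accounts for the arithmetic of pairing and of the stack machine.

  \<open>X1\<close> reads a condition \<Xi>(f, g) as a universal statement, so that "nn halts with
  0" cannot be written down directly, while its impossibility can. Deciding the latter suffices,
  because the diagonal argument asks for a refuted equation and not for knowledge whether nn is
  defined.

  The set is chosen to force a commitment. It is inhabited by {\<emptyset>} without any decision
  about p; \<emptyset> can be the chosen element only if p is true, and {\<emptyset>} only if
  \<emptyset> is not an element, that is, if p is not true. The choice can be read off because
  membership in \<open>EL\<close> comes with an index, and equality of numbers is decidable.\<close>

lemma sbt_sbt: "sbt \<sigma> (sbt \<tau> t) = sbt (\<lambda>i. sbt \<sigma> (\<tau> i)) t"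
  by (induction t) auto

lemma sbt_Var: "sbt Var t = t"
  by (induction t) (auto simp: map_idI)

lemma up_simps [simp]:
  "up \<sigma> 0 = Var 0"
  "up \<sigma> (Suc i) = lift (\<sigma> i)"
  "up \<sigma> (numeral k) = lift (\<sigma> (pred_numeral k))"
  by (simp_all add: up_def numeral_eq_Suc)

lemma up_comp: "sbt (up \<sigma>) (up \<tau> i) = up (\<lambda>i. sbt \<sigma> (\<tau> i)) i"
  by (cases i) (simp_all add: sbt_sbt)

lemma sb_sb: "sb \<sigma> (sb \<tau> \<phi>) = sb (\<lambda>i. sbt \<sigma> (\<tau> i)) \<phi>"
  by (induction \<phi> arbitrary: \<sigma> \<tau>) (auto simp: sbt_sbt up_comp)

lemma up_Var: "up Var = Var"
proof
  fix i show "up Var i = Var i" by (cases i) auto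
qed

lemma sb_Var: "sb Var \<phi> = \<phi>"
  by (induction \<phi>) (auto simp: sbt_Var up_Var)

lemma inst_lift [simp]: "sbt (case_nat t Var) (lift s) = s"
  by (simp add: sbt_sbt sbt_Var)

lemma up_lift [simp]: "sbt (up \<sigma>) (lift s) = lift (sbt \<sigma> s)"
  by (simp add: sbt_sbt)

lemma inst_liftf [simp]: "inst t (liftf \<phi>) = \<phi>"
  by (simp add: sb_sb sb_Var)

lemma up_liftf: "sb (up \<sigma>) (liftf \<phi>) = liftf (sb \<sigma> \<phi>)"
  by (simp add: sb_sb)

lemma sb_app [simp]: "sb \<sigma> (app s t u) = app (sbt \<sigma> s) (sbt \<sigma> t) (sbt \<sigma> u)"
  by (simp add: app_def)

lemma sb_app_sat [simp]: "sb \<sigma> (app_sat s t \<phi>) = app_sat (sbt \<sigma> s) (sbt \<sigma> t) (sb (up \<sigma>) \<phi>)"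
  by (simp add: app_sat_def)

lemma sb_defd [simp]: "sb \<sigma> (defd s t) = defd (sbt \<sigma> s) (sbt \<sigma> t)"
  by (simp add: defd_def)

lemma sb_inEL [simp]: "sb \<sigma> (inEL s t) = inEL (sbt \<sigma> s) (sbt \<sigma> t)"
  by (simp add: inEL_def)

lemma sb_rel2 [simp]: "sb \<sigma> (rel2 E s t) = rel2 E (sbt \<sigma> s) (sbt \<sigma> t)"
proof -
  have "(\<lambda>i. sbt \<sigma> (case_nat s (case_nat t (\<lambda>_. zero)) i))
      = case_nat (sbt \<sigma> s) (case_nat (sbt \<sigma> t) (\<lambda>_. zero))"
    by (auto split: nat.split)
  then show ?thesis by (simp add: rel2_def sb_sb)
qed

section \<open>Finitely many variables in terms and formulas\<close>

lemma ex_bound_tm: "\<exists>K. \<forall>\<sigma> \<tau>. (\<forall>i<K. \<sigma> i = \<tau> i) \<longrightarrow> sbt \<sigma> t = sbt \<tau> t"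
proof (induction t)
  case (Var i)
  show ?case by (intro exI[of _ "Suc i"]) simp
next
  case (Fn f ts)
  then have "\<forall>t\<in>set ts. \<exists>K. \<forall>\<sigma> \<tau>. (\<forall>i<K. \<sigma> i = \<tau> i) \<longrightarrow> sbt \<sigma> t = sbt \<tau> t"
    by blast
  then obtain K where K: "\<forall>t\<in>set ts. \<forall>\<sigma> \<tau>. (\<forall>i<K t. \<sigma> i = \<tau> i) \<longrightarrow> sbt \<sigma> t = sbt \<tau> t"
    by metis
  have "K t \<le> sum_list (map K ts)" if "t \<in> set ts" for t
    using that by (simp add: member_le_sum_list)
  with K show ?case
    by (intro exI[of _ "sum_list (map K ts)"]) (auto, meson order_less_le_trans)
qed

text \<open>The bound serves two purposes: it supplies a fresh variable, and it lets finitely many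
  specializations do the work of a simultaneous substitution.\<close>

lemma ex_bound_fm: "\<exists>K. \<forall>\<sigma> \<tau>. (\<forall>i<K. \<sigma> i = \<tau> i) \<longrightarrow> sb \<sigma> \<phi> = sb \<tau> \<phi>"
proof -
  have two_tm: "\<exists>K. \<forall>\<sigma> \<tau>. (\<forall>i<K. \<sigma> i = \<tau> i) \<longrightarrow> sbt \<sigma> s = sbt \<tau> s \<and> sbt \<sigma> t = sbt \<tau> t" for s t
  proof -
    obtain K where "\<forall>\<sigma> \<tau>. (\<forall>i<K. \<sigma> i = \<tau> i) \<longrightarrow> sbt \<sigma> (Fn PZ [s, t]) = sbt \<tau> (Fn PZ [s, t])"
      using ex_bound_tm by blast
    then show ?thesis by auto
  qed
  have two: "\<exists>K. \<forall>\<sigma> \<tau>. (\<forall>i<K. \<sigma> i = \<tau> i) \<longrightarrow> sb \<sigma> \<phi> = sb \<tau> \<phi> \<and> sb \<sigma> \<psi> = sb \<tau> \<psi>"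
    if "\<forall>\<sigma> \<tau>. (\<forall>i<K. \<sigma> i = \<tau> i) \<longrightarrow> sb \<sigma> \<phi> = sb \<tau> \<phi>"
      "\<forall>\<sigma> \<tau>. (\<forall>i<K'. \<sigma> i = \<tau> i) \<longrightarrow> sb \<sigma> \<psi> = sb \<tau> \<psi>" for K K' :: nat and \<phi> \<psi>
    using that by (intro exI[of _ "K + K'"]) (meson trans_less_add1 trans_less_add2)
  \<comment> \<open>The bound of the body also works for the quantified formula: \<open>up\<close>
    fixes index 0 and moves index i to i + 1, so agreement below K is kept.\<close>
  have bind: "\<forall>\<sigma> \<tau>. (\<forall>i<K. \<sigma> i = \<tau> i) \<longrightarrow> sb (up \<sigma>) \<phi> = sb (up \<tau>) \<phi>"
    if *: "\<forall>\<sigma> \<tau>. (\<forall>i<K. \<sigma> i = \<tau> i) \<longrightarrow> sb \<sigma> \<phi> = sb \<tau> \<phi>" for K :: nat and \<phi>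
  proof (intro allI impI)
    fix \<sigma> \<tau> :: "nat \<Rightarrow> tm" assume "\<forall>i<K. \<sigma> i = \<tau> i"
    then have "\<forall>i<K. up \<sigma> i = up \<tau> i" by (auto simp: up_def split: nat.split)
    then show "sb (up \<sigma>) \<phi> = sb (up \<tau>) \<phi>" using * by blast
  qed
  show ?thesis
  proof (induction \<phi>)
    case (Eq s t)
    show ?case using two_tm[of s t] by simp
  next
    case (PV t)
    show ?case using ex_bound_tm[of t] by simp
  next
    case (PM t)
    show ?case using ex_bound_tm[of t] by simp
  next
    case (PT t)
    show ?case using ex_bound_tm[of t] by simp
  next
    case (And \<phi> \<psi>)
    then show ?case using two[of _ \<phi> _ \<psi>] by simp metis
  next
    case (Or \<phi> \<psi>)
    then show ?case using two[of _ \<phi> _ \<psi>] by simp metis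
  next
    case (Imp \<phi> \<psi>)
    then show ?case using two[of _ \<phi> _ \<psi>] by simp metis
  next
    case (All \<phi>)
    then show ?case using bind[of _ \<phi>] by simp metis
  next
    case (Ex \<phi>)
    then show ?case using bind[of _ \<phi>] by simp metis
  qed simp
qed

lemma ex_bound_fms:
  assumes "finite \<Gamma>"
  shows "\<exists>K. \<forall>\<phi>\<in>\<Gamma>. \<forall>\<sigma> \<tau>. (\<forall>i<K. \<sigma> i = \<tau> i) \<longrightarrow> sb \<sigma> \<phi> = sb \<tau> \<phi>"
  using assms
proof (induction \<Gamma>)
  case (insert \<phi> \<Gamma>)
  then obtain K K' where "\<forall>\<phi>\<in>\<Gamma>. \<forall>\<sigma> \<tau>. (\<forall>i<K. \<sigma> i = \<tau> i) \<longrightarrow> sb \<sigma> \<phi> = sb \<tau> \<phi>"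
    "\<forall>\<sigma> \<tau>. (\<forall>i<K'. \<sigma> i = \<tau> i) \<longrightarrow> sb \<sigma> \<phi> = sb \<tau> \<phi>"
    using ex_bound_fm by metis
  then show ?case
    by (intro exI[of _ "K + K'"]) (metis insert_iff trans_less_add1 trans_less_add2)
qed simp


section \<open>Derived rules of natural deduction\<close>

lemma proves_mono: "proves Ax \<Gamma> \<phi> \<Longrightarrow> \<Gamma> \<subseteq> \<Delta> \<Longrightarrow> proves Ax \<Delta> \<phi>"
proof (induction arbitrary: \<Delta> rule: proves.induct)
  case (OrE \<Gamma> \<phi> \<psi> \<chi>)
  then show ?case by (meson insert_mono proves.OrE)
next
  case (ImpI \<phi> \<Gamma> \<psi>)
  then show ?case by (meson insert_mono proves.ImpI)
next
  case (AllI \<Gamma> \<phi>)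
  then show ?case by (intro proves.AllI) (simp add: image_mono)
next
  case (ExE \<Gamma> \<phi> \<chi>)
  have "proves Ax (insert \<phi> (liftf ` \<Delta>)) (liftf \<chi>)"
    using ExE.prems by (intro ExE.IH(2)) blast
  then show ?case by (rule proves.ExE[OF ExE.IH(1)[OF ExE.prems]])
qed (blast intro: proves.intros)+

lemma up_funpow_below: "i < K \<Longrightarrow> (up ^^ K) \<sigma> i = Var i"
proof (induction K arbitrary: i)
  case (Suc K)
  then show ?case by (cases i) auto
qed simp

lemma up_funpow_above: "(up ^^ K) \<sigma> (K + j) = sbt (\<lambda>i. Var (i + K)) (\<sigma> j)"
  by (induction K) (simp_all add: sbt_Var sbt_sbt)

lemma sb_All_funpow: "sb \<sigma> ((All ^^ K) \<phi>) = (All ^^ K) (sb ((up ^^ K) \<sigma>) \<phi>)"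
  by (induction K arbitrary: \<sigma>) (simp_all add: funpow_swap1[where f = up])

lemma proves_closure: "proves Ax {} \<phi> \<Longrightarrow> proves Ax {} ((All ^^ K) \<phi>)"
  by (induction K) (simp_all add: AllI)

lemma proves_All_funpowE:
  "proves Ax {} ((All ^^ K) \<phi>) \<Longrightarrow> proves Ax {} (sb (\<lambda>i. if i < K then \<sigma> i else Var (i - K)) \<phi>)"
proof (induction K arbitrary: \<phi>)
  case 0
  then show ?case by (simp add: sb_Var)
next
  case (Suc K)
  \<comment> \<open>The outermost of the \<open>Suc K\<close> quantifiers binds index K of the body,
    so it is the one to receive \<open>\<sigma> K\<close>.\<close>
  let ?\<tau> = "case_nat (\<sigma> K) Var"
  let ?\<rho> = "\<lambda>K i. if i < K then \<sigma> i else Var (i - K)"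
  have "proves Ax {} (All ((All ^^ K) \<phi>))" using Suc.prems by simp
  from AllE[OF this, of "\<sigma> K"] have "proves Ax {} ((All ^^ K) (sb ((up ^^ K) ?\<tau>) \<phi>))"
    by (simp add: sb_All_funpow)
  from Suc.IH[OF this] have "proves Ax {} (sb (\<lambda>i. sbt (?\<rho> K) ((up ^^ K) ?\<tau> i)) \<phi>)"
    by (simp add: sb_sb)
  moreover have "(\<lambda>i. sbt (?\<rho> K) ((up ^^ K) ?\<tau> i)) = ?\<rho> (Suc K)"
  proof
    fix i
    show "sbt (?\<rho> K) ((up ^^ K) ?\<tau> i) = ?\<rho> (Suc K) i"
    proof (cases "i < K")
      case True
      then show ?thesis by (simp add: up_funpow_below)
    next
      case False
      then obtain j where j: "i = K + j" using le_Suc_ex not_less by blast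
      show ?thesis unfolding j up_funpow_above by (cases j) (simp_all add: sbt_sbt sbt_Var)
    qed
  qed
  ultimately show ?case by simp
qed

lemma proves_sb_empty:
  assumes "proves Ax {} \<phi>"
  shows "proves Ax {} (sb \<sigma> \<phi>)"
proof -
  obtain K where "\<forall>\<sigma> \<tau>. (\<forall>i<K. \<sigma> i = \<tau> i) \<longrightarrow> sb \<sigma> \<phi> = sb \<tau> \<phi>"
    using ex_bound_fm by blast
  then have "sb \<sigma> \<phi> = sb (\<lambda>i. if i < K then \<sigma> i else Var (i - K)) \<phi>" by simp
  then show ?thesis using proves_All_funpowE[OF proves_closure[OF assms]] by metis
qed

text \<open>No closure of the axioms under substitution is needed: the free variables are generalized
  and then specialized.\<close>

lemma proves_sb:
  assumes "finite \<Gamma>" "proves Ax \<Gamma> \<phi>"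
  shows "proves Ax (sb \<sigma> ` \<Gamma>) (sb \<sigma> \<phi>)"
  using assms
proof (induction \<Gamma> arbitrary: \<phi>)
  case empty
  then show ?case by (simp add: proves_sb_empty)
next
  case (insert \<gamma> \<Gamma>)
  then have "proves Ax (sb \<sigma> ` \<Gamma>) (sb \<sigma> \<gamma> \<^bold>\<longrightarrow> sb \<sigma> \<phi>)"
    by (metis ImpI sb.simps(8))
  then have "proves Ax (insert (sb \<sigma> \<gamma>) (sb \<sigma> ` \<Gamma>)) (sb \<sigma> \<gamma> \<^bold>\<longrightarrow> sb \<sigma> \<phi>)"
    by (rule proves_mono) auto
  then show ?case by (metis ImpE hyp image_insert insertI1)
qed

text \<open>One instance is enough, namely the one at a variable K that occurs neither in \<phi> nor
  in \<Gamma>; renaming it turns the instance into the derivation with an eigenvariable. This lets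
  the quantifier rules be stated with arbitrary terms.\<close>

lemma proves_fresh:
  assumes "finite \<Gamma>" and inst: "\<And>t. proves Ax \<Gamma> (inst t \<phi>)"
  shows "proves Ax (liftf ` \<Gamma>) \<phi>"
proof -
  obtain K where K: "\<forall>\<psi>\<in>insert \<phi> \<Gamma>. \<forall>\<sigma> \<tau>. (\<forall>i<K. \<sigma> i = \<tau> i) \<longrightarrow> sb \<sigma> \<psi> = sb \<tau> \<psi>"
    using ex_bound_fms[of "insert \<phi> \<Gamma>"] assms(1) by auto
  \<comment> \<open>The fresh variable goes to the eigenvariable \<open>Var 0\<close>; below K,
    where everything else lives, \<sigma> is the ordinary lifting.\<close>
  define \<sigma> where "\<sigma> i = (if i = K then Var 0 else Var (Suc i))" for i
  have "sb \<sigma> ` \<Gamma> = liftf ` \<Gamma>"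
    using K by (intro image_cong) (auto simp: \<sigma>_def)
  moreover have "sb \<sigma> (inst (Var K) \<phi>) = sb Var \<phi>"
  proof -
    have "sbt \<sigma> (case_nat (Var K) Var i) = Var i" if "i < K" for i
      using that by (cases i) (auto simp: \<sigma>_def)
    then show ?thesis unfolding sb_sb by (intro K[rule_format]) auto
  qed
  ultimately show ?thesis
    using proves_sb[OF assms(1) inst[of "Var K"], of \<sigma>] by (simp add: sb_Var)
qed

text \<open>Finiteness is built in because \<open>proves_fresh\<close> needs a variable that is
  fresh for the whole context.\<close>

definition ext :: "fm set \<Rightarrow> fm set \<Rightarrow> bool" (infix "\<sqsubseteq>" 50) where
  "\<Gamma> \<sqsubseteq> \<Delta> \<longleftrightarrow> \<Gamma> \<subseteq> \<Delta> \<and> finite \<Delta>"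

lemma ext_finite: "\<Gamma> \<sqsubseteq> \<Delta> \<Longrightarrow> finite \<Delta>"
  by (simp add: ext_def)

lemma ext_refl: "finite \<Gamma> \<Longrightarrow> \<Gamma> \<sqsubseteq> \<Gamma>"
  by (simp add: ext_def)

lemma ext_trans [trans]: "\<Gamma> \<sqsubseteq> \<Delta> \<Longrightarrow> \<Delta> \<sqsubseteq> \<Theta> \<Longrightarrow> \<Gamma> \<sqsubseteq> \<Theta>"
  by (auto simp: ext_def)

text \<open>The rules below treat provability in finite contexts like forcing in a Kripke model whose
  worlds are the contexts: object-level hypotheses and eigenvariables become hypotheses
  about all larger contexts and all terms.\<close>

locale ha =
  fixes Ax :: "fm set"
  assumes HA_Ax: "HA \<subseteq> Ax"
begin

abbreviation prv :: "fm set \<Rightarrow> fm \<Rightarrow> bool" (infix "\<turnstile>" 40) where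
  "\<Gamma> \<turnstile> \<phi> \<equiv> proves Ax \<Gamma> \<phi>"

lemma wk: "\<Gamma> \<turnstile> \<phi> \<Longrightarrow> \<Gamma> \<sqsubseteq> \<Delta> \<Longrightarrow> \<Delta> \<turnstile> \<phi>"
  by (auto simp: ext_def intro: proves_mono)

lemma Imp_ext:
  assumes "finite \<Gamma>" "\<And>\<Delta>. \<Gamma> \<sqsubseteq> \<Delta> \<Longrightarrow> \<Delta> \<turnstile> \<phi> \<Longrightarrow> \<Delta> \<turnstile> \<psi>"
  shows "\<Gamma> \<turnstile> \<phi> \<^bold>\<longrightarrow> \<psi>"
  by (rule ImpI, rule assms(2)) (auto simp: ext_def assms(1) intro: hyp)

lemma Or_ext:
  assumes "finite \<Gamma>" "\<Gamma> \<turnstile> \<phi> \<^bold>\<or> \<psi>"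
    "\<And>\<Delta>. \<Gamma> \<sqsubseteq> \<Delta> \<Longrightarrow> \<Delta> \<turnstile> \<phi> \<Longrightarrow> \<Delta> \<turnstile> \<chi>" "\<And>\<Delta>. \<Gamma> \<sqsubseteq> \<Delta> \<Longrightarrow> \<Delta> \<turnstile> \<psi> \<Longrightarrow> \<Delta> \<turnstile> \<chi>"
  shows "\<Gamma> \<turnstile> \<chi>"
  using OrE[OF assms(2), of \<chi>] Imp_ext assms
  by (metis ImpE finite_insert hyp insertI1 ext_def subset_insertI)

lemma All_terms:
  assumes "finite \<Gamma>" "\<And>t. \<Gamma> \<turnstile> inst t \<phi>"
  shows "\<Gamma> \<turnstile> All \<phi>"
  using assms by (intro AllI proves_fresh)

lemma Ex_ext:
  assumes "finite \<Gamma>" "\<Gamma> \<turnstile> Ex \<phi>" "\<And>\<Delta> t. \<Gamma> \<sqsubseteq> \<Delta> \<Longrightarrow> \<Delta> \<turnstile> inst t \<phi> \<Longrightarrow> \<Delta> \<turnstile> \<chi>"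
  shows "\<Gamma> \<turnstile> \<chi>"
proof (rule ExE[OF assms(2)])
  have "\<Gamma> \<turnstile> inst t (\<phi> \<^bold>\<longrightarrow> liftf \<chi>)" for t
    using assms(1,3) by (simp add: Imp_ext)
  then have "liftf ` \<Gamma> \<turnstile> \<phi> \<^bold>\<longrightarrow> liftf \<chi>"
    using assms(1) by (intro proves_fresh)
  then have "insert \<phi> (liftf ` \<Gamma>) \<turnstile> \<phi> \<^bold>\<longrightarrow> liftf \<chi>"
    by (rule proves_mono) auto
  then show "insert \<phi> (liftf ` \<Gamma>) \<turnstile> liftf \<chi>"
    by (rule ImpE) (simp add: hyp)
qed

lemma ha: "\<phi> \<in> HA \<Longrightarrow> \<Gamma> \<turnstile> \<phi>"
  using HA_Ax by (blast intro: axm)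

lemma ind_ext:
  assumes "finite \<Gamma>" "\<Gamma> \<turnstile> inst zero \<phi>"
    "\<And>\<Delta> t. \<Gamma> \<sqsubseteq> \<Delta> \<Longrightarrow> \<Delta> \<turnstile> inst t \<phi> \<Longrightarrow> \<Delta> \<turnstile> inst (succ t) \<phi>"
  shows "\<Gamma> \<turnstile> inst s \<phi>"
proof -
  let ?\<psi> = "sb (case_nat (succ (Var 0)) (\<lambda>i. Var (Suc i))) \<phi>"
  have "inst t ?\<psi> = inst (succ t) \<phi>" for t
  proof -
    have "(\<lambda>i. sbt (case_nat t Var) (case_nat (succ (Var 0)) (\<lambda>i. Var (Suc i)) i))
        = case_nat (succ t) Var"
      by (auto split: nat.split)
    then show ?thesis by (simp add: sb_sb)
  qed
  then have "\<Gamma> \<turnstile> All (\<phi> \<^bold>\<longrightarrow> ?\<psi>)"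
    using assms(1,3) by (intro All_terms) (simp_all add: Imp_ext)
  with assms(2) have "\<Gamma> \<turnstile> All \<phi>"
    by (blast intro: ImpE ha HA.ind AndI)
  then show ?thesis by (rule AllE)
qed


section \<open>Computing with provable equality\<close>

lemma eq_subst: "\<Gamma> \<turnstile> s \<^bold>= t \<Longrightarrow> \<Gamma> \<turnstile> inst s \<phi> \<Longrightarrow> \<Gamma> \<turnstile> inst t \<phi>"
  by (meson ImpE ha HA.eq_subst)

lemma eq_refl: "\<Gamma> \<turnstile> t \<^bold>= t"
  by (simp add: ha HA.eq_refl)

lemma eq_sym: "\<Gamma> \<turnstile> s \<^bold>= t \<Longrightarrow> \<Gamma> \<turnstile> t \<^bold>= s"
  using eq_subst[of \<Gamma> s t "Var 0 \<^bold>= lift s"] by (simp add: eq_refl)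

lemma eq_trans: "\<Gamma> \<turnstile> s \<^bold>= t \<Longrightarrow> \<Gamma> \<turnstile> t \<^bold>= u \<Longrightarrow> \<Gamma> \<turnstile> s \<^bold>= u"
  using eq_subst[of \<Gamma> t u "lift s \<^bold>= Var 0"] by simp

lemma map_inst_lift [simp]: "map (sbt (case_nat t Var) \<circ> lift) ts = ts"
  by (simp add: map_idI)

lemma eq_Fn: "\<Gamma> \<turnstile> s \<^bold>= t \<Longrightarrow> \<Gamma> \<turnstile> Fn f (xs @ s # ys) \<^bold>= Fn f (xs @ t # ys)"
  using eq_subst[of \<Gamma> s t "Fn f (map lift (xs @ s # ys)) \<^bold>= Fn f (map lift xs @ Var 0 # map lift ys)"]
  by (simp add: eq_refl)

lemma eq_Fn_list: "list_all2 (\<lambda>s t. \<Gamma> \<turnstile> s \<^bold>= t) ss ts \<Longrightarrow> \<Gamma> \<turnstile> Fn f (xs @ ss) \<^bold>= Fn f (xs @ ts)"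
proof (induction arbitrary: xs rule: list_all2_induct)
  case Nil
  then show ?case by (simp add: eq_refl)
next
  case (Cons s ss t ts)
  from Cons(3)[of "xs @ [s]"] eq_Fn[OF Cons(1)] show ?case
    by (auto intro: eq_trans)
qed

text \<open>A canonical representative of the class of a term under provable equality turns provable
  equality into equality, so that the simplifier can compute in the object theory.\<close>

definition nf :: "fm set \<Rightarrow> tm \<Rightarrow> tm" where
  "nf \<Gamma> t = (SOME s. \<Gamma> \<turnstile> s \<^bold>= t)"

text \<open>Numbers show up in normalized terms as \<open>ap \<Gamma> PZ []\<close> and
  \<open>ap \<Gamma> PS [x]\<close>, which are the patterns that the computation rules match on;
  \<open>nf_Fn\<close> pushes normalization down to the arguments.\<close>

definition ap :: "fm set \<Rightarrow> prfun \<Rightarrow> tm list \<Rightarrow> tm" where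
  "ap \<Gamma> f ts = nf \<Gamma> (Fn f ts)"

lemma nf_eq: "\<Gamma> \<turnstile> nf \<Gamma> t \<^bold>= t"
  unfolding nf_def by (rule someI[of "\<lambda>s. \<Gamma> \<turnstile> s \<^bold>= t"]) (rule eq_refl)

lemma eq_iff_nf: "(\<Gamma> \<turnstile> s \<^bold>= t) \<longleftrightarrow> nf \<Gamma> s = nf \<Gamma> t"
proof
  assume "\<Gamma> \<turnstile> s \<^bold>= t"
  then have "(\<Gamma> \<turnstile> r \<^bold>= s) \<longleftrightarrow> (\<Gamma> \<turnstile> r \<^bold>= t)" for r
    by (meson eq_sym eq_trans)
  then show "nf \<Gamma> s = nf \<Gamma> t" by (simp add: nf_def)
next
  assume "nf \<Gamma> s = nf \<Gamma> t"
  then show "\<Gamma> \<turnstile> s \<^bold>= t" by (metis nf_eq eq_sym eq_trans)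
qed

lemma nf_nf [simp]: "nf \<Gamma> (nf \<Gamma> t) = nf \<Gamma> t"
  using nf_eq eq_iff_nf by blast

lemma nf_ap [simp]: "nf \<Gamma> (ap \<Gamma> f ts) = ap \<Gamma> f ts"
  by (simp add: ap_def)

lemma ap_cong: "map (nf \<Gamma>) ss = map (nf \<Gamma>) ts \<Longrightarrow> ap \<Gamma> f ss = ap \<Gamma> f ts"
  using eq_Fn_list[of \<Gamma> ss ts f "[]"]
  by (auto simp: ap_def eq_iff_nf[symmetric] list_all2_conv_all_nth list_eq_iff_nth_eq)

lemma nf_Fn [simp]: "nf \<Gamma> (Fn f ts) = ap \<Gamma> f (map (nf \<Gamma>) ts)"
  unfolding ap_def[symmetric] by (rule ap_cong) simp

text \<open>The condition on \<open>ts\<close> keeps the rule from rewriting its own right-hand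
  side.\<close>

lemma ap_Z: "ts \<noteq> [] \<Longrightarrow> ap \<Gamma> PZ ts = ap \<Gamma> PZ []"
  unfolding ap_def eq_iff_nf[symmetric] by (simp add: ha HA.pr_Z)

lemma ap_Proj [simp]: "i < length ts \<Longrightarrow> ap \<Gamma> (PProj i) ts = nf \<Gamma> (ts ! i)"
  unfolding ap_def eq_iff_nf[symmetric] by (simp add: ha HA.pr_Proj)

lemma ap_Cn [simp]: "ap \<Gamma> (PCn f gs) ts = ap \<Gamma> f (map (\<lambda>g. ap \<Gamma> g ts) gs)"
proof -
  have "ap \<Gamma> (PCn f gs) ts = ap \<Gamma> f (map (\<lambda>g. Fn g ts) gs)"
    unfolding ap_def eq_iff_nf[symmetric] by (simp add: ha HA.pr_Cn)
  also have "\<dots> = ap \<Gamma> f (map (\<lambda>g. ap \<Gamma> g ts) gs)"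
    by (rule ap_cong) (simp add: ap_def del: nf_Fn)
  finally show ?thesis .
qed

lemma ap_Pr0: "ap \<Gamma> (PPr f g) (ap \<Gamma> PZ [] # ts) = ap \<Gamma> f ts"
proof -
  have "ap \<Gamma> (PPr f g) (ap \<Gamma> PZ [] # ts) = ap \<Gamma> (PPr f g) (zero # ts)"
    by (rule ap_cong) simp
  also have "\<dots> = ap \<Gamma> f ts"
    unfolding ap_def eq_iff_nf[symmetric] by (simp add: ha HA.pr_Pr0)
  finally show ?thesis .
qed

lemma ap_PrS: "ap \<Gamma> (PPr f g) (ap \<Gamma> PS [t] # ts) = ap \<Gamma> g (t # ap \<Gamma> (PPr f g) (t # ts) # ts)"
proof -
  have "ap \<Gamma> (PPr f g) (ap \<Gamma> PS [t] # ts) = ap \<Gamma> (PPr f g) (succ t # ts)"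
    by (rule ap_cong) (simp add: ap_def del: nf_Fn)
  also have "\<dots> = ap \<Gamma> g (t # Fn (PPr f g) (t # ts) # ts)"
    unfolding ap_def eq_iff_nf[symmetric] by (simp add: ha HA.pr_PrS)
  also have "\<dots> = ap \<Gamma> g (t # ap \<Gamma> (PPr f g) (t # ts) # ts)"
    by (rule ap_cong) (simp add: ap_def del: nf_Fn)
  finally show ?thesis .
qed

lemma ap_nf_args:
  "ap \<Gamma> f [nf \<Gamma> s] = ap \<Gamma> f [s]"
  "ap \<Gamma> f [nf \<Gamma> s, t] = ap \<Gamma> f [s, t]"
  "ap \<Gamma> f [s, nf \<Gamma> t] = ap \<Gamma> f [s, t]"
  "ap \<Gamma> f [nf \<Gamma> s, t, u] = ap \<Gamma> f [s, t, u]"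
  "ap \<Gamma> f [s, nf \<Gamma> t, u] = ap \<Gamma> f [s, t, u]"
  "ap \<Gamma> f [s, t, nf \<Gamma> u] = ap \<Gamma> f [s, t, u]"
  by (rule ap_cong, simp)+


section \<open>Addition and truncated subtraction in Heyting arithmetic\<close>

lemma ap_add [simp]:
  "ap \<Gamma> pr_add [ap \<Gamma> PZ [], y] = nf \<Gamma> y"
  "ap \<Gamma> pr_add [ap \<Gamma> PS [x], y] = ap \<Gamma> PS [ap \<Gamma> pr_add [x, y]]"
  by (simp_all add: pr_add_def ap_Pr0 ap_PrS)

lemma ap_pred [simp]:
  "ap \<Gamma> pr_pred [ap \<Gamma> PZ []] = ap \<Gamma> PZ []"
  "ap \<Gamma> pr_pred [ap \<Gamma> PS [x]] = nf \<Gamma> x"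
  by (simp_all add: pr_pred_def ap_Pr0 ap_PrS)

lemma ap_rsub [simp]:
  "ap \<Gamma> pr_rsub [ap \<Gamma> PZ [], x] = nf \<Gamma> x"
  "ap \<Gamma> pr_rsub [ap \<Gamma> PS [y], x] = ap \<Gamma> pr_pred [ap \<Gamma> pr_rsub [y, x]]"
  by (simp_all add: pr_rsub_def ap_Pr0 ap_PrS)

lemma ap_ifz [simp]:
  "ap \<Gamma> pr_ifz [ap \<Gamma> PZ [], x, y] = nf \<Gamma> x"
  "ap \<Gamma> pr_ifz [ap \<Gamma> PS [t], x, y] = nf \<Gamma> y"
  by (simp_all add: pr_ifz_def ap_Pr0 ap_PrS)

lemma ap_tri [simp]:
  "ap \<Gamma> pr_tri [ap \<Gamma> PZ []] = ap \<Gamma> PZ []"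
  "ap \<Gamma> pr_tri [ap \<Gamma> PS [x]] = ap \<Gamma> pr_add [ap \<Gamma> pr_tri [x], ap \<Gamma> PS [x]]"
  by (simp_all add: pr_tri_def ap_Pr0 ap_PrS ap_nf_args)

text \<open>Recursion is on the first argument, so equations for the second one need induction in
  the object theory. That is where \<open>finite \<Gamma>\<close> enters the rewriting.\<close>

lemma ap_add_Z_right [simp]:
  assumes "finite \<Gamma>"
  shows "ap \<Gamma> pr_add [x, ap \<Gamma> PZ []] = nf \<Gamma> x"
  using ind_ext[OF assms, of "Fn pr_add [Var 0, zero] \<^bold>= Var 0" x]
  by (simp add: eq_iff_nf ap_nf_args(1-3))

lemma ap_add_S_right [simp]:
  assumes "finite \<Gamma>"
  shows "ap \<Gamma> pr_add [x, ap \<Gamma> PS [y]] = ap \<Gamma> PS [ap \<Gamma> pr_add [x, y]]"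
  using ind_ext[OF assms, of "Fn pr_add [Var 0, succ (lift y)] \<^bold>= succ (Fn pr_add [Var 0, lift y])" x]
  by (simp add: eq_iff_nf ap_nf_args(1-3))

lemma ap_add_commute:
  assumes "finite \<Gamma>"
  shows "ap \<Gamma> pr_add [x, y] = ap \<Gamma> pr_add [y, x]"
proof -
  have "\<Gamma> \<turnstile> inst x (Fn pr_add [Var 0, lift y] \<^bold>= Fn pr_add [lift y, Var 0])"
    by (rule ind_ext[OF assms]) (simp_all add: eq_iff_nf assms ext_finite)
  then show ?thesis by (simp add: eq_iff_nf ap_nf_args(1-3))
qed

text \<open>The recursion of \<open>pr_rsub\<close> brings S x - S y into the form of the left-hand
  side. In this guise the cancellation S x - S y = x - y carries the induction of
  \<open>ap_rsub_add_add\<close>.\<close>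

lemma ap_rsub_S_S [simp]:
  assumes "finite \<Gamma>"
  shows "ap \<Gamma> pr_pred [ap \<Gamma> pr_rsub [y, ap \<Gamma> PS [x]]] = ap \<Gamma> pr_rsub [y, x]"
proof -
  have "\<Gamma> \<turnstile> inst y (Fn pr_pred [Fn pr_rsub [Var 0, succ (lift x)]] \<^bold>= Fn pr_rsub [Var 0, lift x])"
    by (rule ind_ext[OF assms]) (simp_all add: eq_iff_nf assms ext_finite)
  then show ?thesis by (simp add: eq_iff_nf ap_nf_args(1-3))
qed

lemma ap_rsub_add_add:
  assumes "finite \<Gamma>"
  shows "ap \<Gamma> pr_rsub [ap \<Gamma> pr_add [z, y], ap \<Gamma> pr_add [z, x]] = ap \<Gamma> pr_rsub [y, x]"
proof -
  have "\<Gamma> \<turnstile> inst z (Fn pr_rsub [Fn pr_add [Var 0, lift y], Fn pr_add [Var 0, lift x]]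
      \<^bold>= Fn pr_rsub [lift y, lift x])"
    by (rule ind_ext[OF assms]) (simp_all add: eq_iff_nf assms ext_finite)
  then show ?thesis by (simp add: eq_iff_nf ap_nf_args(1-3))
qed

lemma ap_rsub_add [simp]:
  assumes "finite \<Gamma>"
  shows "ap \<Gamma> pr_rsub [x, ap \<Gamma> pr_add [x, y]] = nf \<Gamma> y"
  using ap_rsub_add_add[OF assms, of x "ap \<Gamma> PZ []" y] assms
  by (simp add: ap_nf_args(1-3))

section \<open>Triangular roots and the projections of Cantor pairs\<close>

lemma ap_root_Z: "ap \<Gamma> pr_root [ap \<Gamma> PZ []] = ap \<Gamma> PZ []"
  by (simp add: pr_root_def ap_Pr0)

lemma ap_root_S: "ap \<Gamma> pr_root [ap \<Gamma> PS [n]] =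
  (let r = ap \<Gamma> pr_root [n]
   in ap \<Gamma> pr_ifz [ap \<Gamma> pr_rsub [ap \<Gamma> PS [n], ap \<Gamma> pr_tri [ap \<Gamma> PS [r]]], ap \<Gamma> PS [r], r])"
  by (simp add: pr_root_def ap_PrS Let_def ap_nf_args(1-3) del: ap_tri)

text \<open>The recursion compares S(tri r + x) with tri(S r) = tri r + S r. Cancelling leaves the
  test value r - x, so the root moves on exactly when x has reached the end of diagonal r.\<close>

lemma ap_root_S':
  assumes fin: "finite \<Gamma>" and r: "ap \<Gamma> pr_root [ap \<Gamma> pr_add [ap \<Gamma> pr_tri [r], x]] = nf \<Gamma> r"
  shows "ap \<Gamma> pr_root [ap \<Gamma> PS [ap \<Gamma> pr_add [ap \<Gamma> pr_tri [r], x]]]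
    = ap \<Gamma> pr_ifz [ap \<Gamma> pr_rsub [x, r], ap \<Gamma> PS [r], r]"
  using fin by (simp add: ap_root_S r Let_def ap_rsub_add_add ap_nf_args)

text \<open>Walk along the diagonals: the position \<open>(x, S y)\<close> is followed by \<open>(S x, y)\<close>, and
  \<open>(x, 0)\<close> by \<open>(0, S x)\<close>.\<close>

lemma root_diagonal:
  assumes fin: "finite \<Gamma>"
  shows "\<Gamma> \<turnstile> inst x (All (Fn pr_root [Fn pr_tri [Fn pr_add [Var 1, Var 0]]] \<^bold>= Fn pr_add [Var 1, Var 0]
    \<^bold>\<longrightarrow> Fn pr_root [Fn pr_add [Fn pr_tri [Fn pr_add [Var 1, Var 0]], Var 1]] \<^bold>= Fn pr_add [Var 1, Var 0]))"
    (is "_ \<turnstile> inst _ ?\<phi>")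
proof (rule ind_ext[OF fin])
  show "\<Gamma> \<turnstile> inst zero ?\<phi>"
    using fin by (auto simp: eq_iff_nf ext_finite intro!: All_terms Imp_ext)
next
  fix \<Delta> t assume \<Delta>: "\<Gamma> \<sqsubseteq> \<Delta>" and IH: "\<Delta> \<turnstile> inst t ?\<phi>"
  have "\<Theta> \<turnstile> Fn pr_root [Fn pr_add [Fn pr_tri [Fn pr_add [succ t, y]], succ t]] \<^bold>= Fn pr_add [succ t, y]"
    if \<Theta>: "\<Delta> \<sqsubseteq> \<Theta>" and h: "\<Theta> \<turnstile> Fn pr_root [Fn pr_tri [Fn pr_add [succ t, y]]] \<^bold>= Fn pr_add [succ t, y]"
    for \<Theta> y
  proof -
    have fin: "finite \<Theta>" using \<Theta> by (rule ext_finite)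
    let ?r = "ap \<Theta> PS [ap \<Theta> pr_add [nf \<Theta> t, nf \<Theta> y]]"
    from AllE[OF IH[simplified], of "succ y"]
    have "\<Delta> \<turnstile> Fn pr_root [Fn pr_tri [Fn pr_add [t, succ y]]] \<^bold>= Fn pr_add [t, succ y] \<^bold>\<longrightarrow>
      Fn pr_root [Fn pr_add [Fn pr_tri [Fn pr_add [t, succ y]], t]] \<^bold>= Fn pr_add [t, succ y]"
      by simp
    from wk[OF this \<Theta>] have
      "\<Theta> \<turnstile> Fn pr_root [Fn pr_add [Fn pr_tri [Fn pr_add [t, succ y]], t]] \<^bold>= Fn pr_add [t, succ y]"
      using h fin by (elim ImpE) (simp add: eq_iff_nf del: ap_tri)
    then have r: "ap \<Theta> pr_root [ap \<Theta> pr_add [ap \<Theta> pr_tri [?r], nf \<Theta> t]] = nf \<Theta> ?r"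
      using fin by (simp add: eq_iff_nf del: ap_tri)
    \<comment> \<open>Subtracting t from the diagonal number leaves S y, which is nonzero; the root
      therefore stays where it is.\<close>
    have "ap \<Theta> pr_rsub [nf \<Theta> t, ?r] = ap \<Theta> PS [nf \<Theta> y]"
      using fin ap_rsub_add[OF fin, of "nf \<Theta> t" "ap \<Theta> PS [nf \<Theta> y]"] by simp
    with ap_root_S'[OF fin r] show ?thesis
      using fin by (simp add: eq_iff_nf del: ap_tri)
  qed
  then show "\<Delta> \<turnstile> inst (succ t) ?\<phi>"
    using \<Delta> by (auto simp: ext_finite intro!: All_terms Imp_ext)
qed

text \<open>Diagonal S t begins right after the last position (t, 0) of diagonal t. There the test
  value t - t is zero, so the root advances; the induction hypothesis discharges the premise of
  \<open>root_diagonal\<close>.\<close>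

lemma root_tri:
  assumes fin: "finite \<Gamma>"
  shows "\<Gamma> \<turnstile> inst s (Fn pr_root [Fn pr_tri [Var 0]] \<^bold>= Var 0)"
proof (rule ind_ext[OF fin])
  fix \<Delta> t assume \<Delta>: "\<Gamma> \<sqsubseteq> \<Delta>" and IH: "\<Delta> \<turnstile> inst t (Fn pr_root [Fn pr_tri [Var 0]] \<^bold>= Var 0)"
  have fin: "finite \<Delta>" using \<Delta> by (rule ext_finite)
  from AllE[OF root_diagonal[OF fin, of t, simplified], of zero] IH
  have r: "ap \<Delta> pr_root [ap \<Delta> pr_add [ap \<Delta> pr_tri [nf \<Delta> t], nf \<Delta> t]] = nf \<Delta> (nf \<Delta> t)"
    using fin by (auto simp: eq_iff_nf dest: ImpE)
  have "ap \<Delta> pr_rsub [nf \<Delta> t, nf \<Delta> t] = ap \<Delta> PZ []"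
    using ap_rsub_add[OF fin, of "nf \<Delta> t" "ap \<Delta> PZ []"] fin by simp
  then show "\<Delta> \<turnstile> inst (succ t) (Fn pr_root [Fn pr_tri [Var 0]] \<^bold>= Var 0)"
    using ap_root_S'[OF fin r] fin by (simp add: eq_iff_nf)
qed (simp add: eq_iff_nf ap_root_Z)

lemma ap_pair: "ap \<Gamma> pr_pair [x, y] = ap \<Gamma> pr_add [ap \<Gamma> pr_tri [ap \<Gamma> pr_add [x, y]], x]"
  by (simp add: pr_pair_def ap_nf_args)

text \<open>The pair sits at position x of diagonal x + y, so the root recovers the sum; both
  projections are then differences.\<close>

lemma ap_root_pair:
  assumes fin: "finite \<Gamma>"
  shows "ap \<Gamma> pr_root [ap \<Gamma> pr_pair [x, y]] = ap \<Gamma> pr_add [x, y]"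
proof -
  have "\<Gamma> \<turnstile> Fn pr_root [Fn pr_tri [Fn pr_add [x, y]]] \<^bold>= Fn pr_add [x, y]"
    using root_tri[OF fin, of "Fn pr_add [x, y]"] by simp
  with AllE[OF root_diagonal[OF fin, of x, simplified], of y] show ?thesis
    by (auto simp: eq_iff_nf ap_pair ap_nf_args dest: ImpE)
qed

lemma ap_left_pair [simp]:
  "finite \<Gamma> \<Longrightarrow> ap \<Gamma> pr_left [ap \<Gamma> pr_pair [x, y]] = nf \<Gamma> x"
  by (simp add: pr_left_def ap_root_pair) (simp add: ap_pair)

lemma ap_right_pair [simp]:
  "finite \<Gamma> \<Longrightarrow> ap \<Gamma> pr_right [ap \<Gamma> pr_pair [x, y]] = nf \<Gamma> y"
  by (simp add: pr_right_def ap_root_pair ap_nf_args)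

text \<open>A code with a positive tag is nonzero. This lets the machine's test for the returning
  code 0 be evaluated by rewriting, and it tells running configurations from halting ones.\<close>

lemma ap_pair_S:
  assumes "finite \<Gamma>"
  shows "\<exists>z. ap \<Gamma> pr_pair [ap \<Gamma> PS [x], y] = ap \<Gamma> PS [z]"
  using assms by (auto simp: ap_pair simp del: ap_add(2))

lemma ap_ifz_pair_S [simp]:
  assumes "finite \<Gamma>"
  shows "ap \<Gamma> pr_ifz [ap \<Gamma> pr_pair [ap \<Gamma> PS [t], u], x, y] = nf \<Gamma> y"
  using ap_pair_S[OF assms, of t u] by auto

lemma eq_pairD:
  assumes "finite \<Gamma>" "\<Gamma> \<turnstile> pair s t \<^bold>= pair u v"
  shows "\<Gamma> \<turnstile> s \<^bold>= u" "\<Gamma> \<turnstile> t \<^bold>= v"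
proof -
  have *: "ap \<Gamma> pr_pair [nf \<Gamma> s, nf \<Gamma> t] = ap \<Gamma> pr_pair [nf \<Gamma> u, nf \<Gamma> v]"
    using assms(2) by (simp add: eq_iff_nf)
  show "\<Gamma> \<turnstile> s \<^bold>= u"
    using arg_cong[OF *, of "\<lambda>x. ap \<Gamma> pr_left [x]"] assms(1) by (simp add: eq_iff_nf)
  show "\<Gamma> \<turnstile> t \<^bold>= v"
    using arg_cong[OF *, of "\<lambda>x. ap \<Gamma> pr_right [x]"] assms(1) by (simp add: eq_iff_nf)
qed

section \<open>Decidability of equations\<close>

lemma eq_succ_zeroD: "\<Gamma> \<turnstile> succ t \<^bold>= zero \<Longrightarrow> \<Gamma> \<turnstile> \<phi>"
  by (meson FlsE ImpE ha HA.succ_nz)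

text \<open>Double induction: t is quantified inside the induction formula because the successor
  case compares the predecessors. The result makes definitions by cases on an equation available
  intuitionistically.\<close>

lemma eq_dec:
  assumes fin: "finite \<Gamma>"
  shows "\<Gamma> \<turnstile> s \<^bold>= t \<^bold>\<or> Neg (s \<^bold>= t)"
proof -
  let ?\<phi> = "All (Var 1 \<^bold>= Var 0 \<^bold>\<or> Neg (Var 1 \<^bold>= Var 0))"
  have zero_succ: "\<Delta> \<turnstile> zero \<^bold>= succ u \<^bold>\<or> Neg (zero \<^bold>= succ u)" if "finite \<Delta>" for \<Delta> u
    by (intro OrI2 Imp_ext that) (rule eq_succ_zeroD, erule eq_sym)
  have "\<Gamma> \<turnstile> inst s ?\<phi>"
  proof (rule ind_ext[OF fin])
    have "\<Gamma> \<turnstile> inst u (zero \<^bold>= Var 0 \<^bold>\<or> Neg (zero \<^bold>= Var 0))" for u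
      by (rule ind_ext[OF fin]) (auto intro: OrI1 eq_refl zero_succ ext_finite)
    then show "\<Gamma> \<turnstile> inst zero ?\<phi>"
      using fin by (auto intro!: All_terms)
  next
    fix \<Delta> t assume \<Delta>: "\<Gamma> \<sqsubseteq> \<Delta>" and IH: "\<Delta> \<turnstile> inst t ?\<phi>"
    have fin: "finite \<Delta>" using \<Delta> by (rule ext_finite)
    have "\<Delta> \<turnstile> inst u (succ (lift t) \<^bold>= Var 0 \<^bold>\<or> Neg (succ (lift t) \<^bold>= Var 0))" for u
    proof (rule ind_ext[OF fin])
      show "\<Delta> \<turnstile> inst zero (succ (lift t) \<^bold>= Var 0 \<^bold>\<or> Neg (succ (lift t) \<^bold>= Var 0))"
        using fin by (auto intro!: OrI2 Imp_ext elim: eq_succ_zeroD)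
    next
      fix \<Theta> u assume \<Theta>: "\<Delta> \<sqsubseteq> \<Theta>"
      have fin: "finite \<Theta>" using \<Theta> by (rule ext_finite)
      have "\<Theta> \<turnstile> t \<^bold>= u \<^bold>\<or> Neg (t \<^bold>= u)"
        using wk[OF AllE[OF IH[simplified], of u] \<Theta>] by simp
      then have "\<Theta> \<turnstile> succ t \<^bold>= succ u \<^bold>\<or> Neg (succ t \<^bold>= succ u)"
      proof (rule Or_ext[OF fin])
        fix \<Omega> assume "\<Omega> \<turnstile> t \<^bold>= u"
        then show "\<Omega> \<turnstile> succ t \<^bold>= succ u \<^bold>\<or> Neg (succ t \<^bold>= succ u)"
          by (intro OrI1) (simp add: eq_iff_nf)
      next
        fix \<Omega> assume "\<Theta> \<sqsubseteq> \<Omega>" "\<Omega> \<turnstile> Neg (t \<^bold>= u)"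
        then show "\<Omega> \<turnstile> succ t \<^bold>= succ u \<^bold>\<or> Neg (succ t \<^bold>= succ u)"
          by (intro OrI2 Imp_ext) (simp add: ext_finite, meson ImpE wk ha HA.succ_inj)
      qed
      then show "\<Theta> \<turnstile> inst (succ u) (succ (lift t) \<^bold>= Var 0 \<^bold>\<or> Neg (succ (lift t) \<^bold>= Var 0))"
        by simp
    qed
    then show "\<Delta> \<turnstile> inst (succ t) ?\<phi>"
      using fin by (auto intro!: All_terms)
  qed
  then have "\<Gamma> \<turnstile> All (lift s \<^bold>= Var 0 \<^bold>\<or> Neg (lift s \<^bold>= Var 0))" by simp
  from AllE[OF this, of t] show ?thesis by simp
qed

end

section \<open>Kleene application in arithmetic\<close>

text \<open>The search code \<open>\<langle>8, \<langle>2, 0\<rangle>\<rangle>\<close> looks for a zero of the successor function.\<close>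

definition succ_code :: tm where
  "succ_code = pair (succ (succ zero)) zero"

definition loop_code :: tm where
  "loop_code = pair (succ (succ (succ (succ (succ (succ (succ (succ zero)))))))) succ_code"

lemma sbt_loop_code [simp]: "sbt \<sigma> loop_code = loop_code" "sbt \<sigma> succ_code = succ_code"
  by (simp_all add: loop_code_def succ_code_def)

abbreviation conf_tm :: "tm \<Rightarrow> tm \<Rightarrow> tm \<Rightarrow> tm" where
  "conf_tm p v k \<equiv> pair p (pair v k)"

abbreviation halt_tm :: "tm \<Rightarrow> tm" where
  "halt_tm v \<equiv> conf_tm zero v zero"

text \<open>The stack holds one frame, the pending search: tag 4 together with the search code and
  the argument at which its value is awaited.\<close>

abbreviation loop_stack :: "tm \<Rightarrow> tm" where
  "loop_stack v \<equiv> succ (pair (pair (succ (succ (succ (succ zero)))) (pair loop_code v)) zero)"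

context ha
begin

lemma ap_run [simp]:
  "ap \<Gamma> pr_run [ap \<Gamma> PZ [], c] = nf \<Gamma> c"
  "ap \<Gamma> pr_run [ap \<Gamma> PS [z], c] = ap \<Gamma> pr_step [ap \<Gamma> pr_run [z, c]]"
  by (simp_all add: pr_run_def ap_Pr0 ap_PrS)

lemma step_halt: "finite \<Gamma> \<Longrightarrow> \<Gamma> \<turnstile> Fn pr_step [halt_tm v] \<^bold>= halt_tm v"
  by (simp add: eq_iff_nf pr_step_def Let_def ap_Z)

text \<open>A value returned to the search frame is always a successor, so the frame restarts the
  search at the next argument instead of stopping. The three steps close a cycle in which only v
  changes.\<close>

lemma step_loop:
  assumes "finite \<Gamma>"
  shows "\<Gamma> \<turnstile> Fn pr_step [conf_tm loop_code v zero] \<^bold>= conf_tm succ_code v (loop_stack v)"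
    and "\<Gamma> \<turnstile> Fn pr_step [conf_tm succ_code v (loop_stack v)] \<^bold>= conf_tm zero (succ v) (loop_stack v)"
    and "\<Gamma> \<turnstile> Fn pr_step [conf_tm zero (succ v) (loop_stack v)]
        \<^bold>= conf_tm loop_code (pair (lft v) (succ (rgt v))) zero"
  using assms
  by (simp_all add: eq_iff_nf pr_step_def Let_def ap_Z numeral_eq_Suc loop_code_def succ_code_def)

lemma run_halt:
  assumes fin: "finite \<Gamma>"
  shows "\<Gamma> \<turnstile> Fn pr_run [z, halt_tm v] \<^bold>= halt_tm v"
proof -
  have "\<Gamma> \<turnstile> inst z (Fn pr_run [Var 0, halt_tm (lift v)] \<^bold>= halt_tm (lift v))"
    by (rule ind_ext[OF fin])
      (use step_halt in \<open>simp_all add: eq_iff_nf ext_finite\<close>)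
  then show ?thesis by simp
qed

lemma run_add:
  assumes fin: "finite \<Gamma>"
  shows "\<Gamma> \<turnstile> Fn pr_run [Fn pr_add [z, w], c] \<^bold>= Fn pr_run [z, Fn pr_run [w, c]]"
proof -
  have "\<Gamma> \<turnstile> inst z (Fn pr_run [Fn pr_add [Var 0, lift w], lift c]
      \<^bold>= Fn pr_run [Var 0, Fn pr_run [lift w, lift c]])"
    by (rule ind_ext[OF fin]) (simp_all add: eq_iff_nf)
  then show ?thesis by simp
qed

lemma appI: "\<Gamma> \<turnstile> Fn pr_run [z, conf_tm s t zero] \<^bold>= halt_tm u \<Longrightarrow> \<Gamma> \<turnstile> app s t u"
  unfolding app_def by (rule ExI[of _ _ z]) simp

lemma appE:
  assumes "finite \<Gamma>" "\<Gamma> \<turnstile> app s t u"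
    "\<And>\<Delta> z. \<Gamma> \<sqsubseteq> \<Delta> \<Longrightarrow> \<Delta> \<turnstile> Fn pr_run [z, conf_tm s t zero] \<^bold>= halt_tm u \<Longrightarrow> \<Delta> \<turnstile> \<chi>"
  shows "\<Gamma> \<turnstile> \<chi>"
  by (rule Ex_ext[OF assms(1) assms(2)[unfolded app_def]]) (simp add: assms(3))

text \<open>Halting configurations are fixed by the step function. Two halting runs of lengths z and
  w can thus be prolonged to the common length z + w and compared there.\<close>

lemma app_functional:
  assumes fin: "finite \<Gamma>" and "\<Gamma> \<turnstile> app s t u" "\<Gamma> \<turnstile> app s t v"
  shows "\<Gamma> \<turnstile> u \<^bold>= v"
  using fin assms(2)
proof (rule appE)
  fix \<Delta> z assume \<Delta>: "\<Gamma> \<sqsubseteq> \<Delta>" and z: "\<Delta> \<turnstile> Fn pr_run [z, conf_tm s t zero] \<^bold>= halt_tm u"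
  show "\<Delta> \<turnstile> u \<^bold>= v"
    using ext_finite[OF \<Delta>] wk[OF assms(3) \<Delta>]
  proof (rule appE)
    fix \<Theta> w assume \<Theta>: "\<Delta> \<sqsubseteq> \<Theta>" and w: "\<Theta> \<turnstile> Fn pr_run [w, conf_tm s t zero] \<^bold>= halt_tm v"
    have fin: "finite \<Theta>" using \<Theta> by (rule ext_finite)
    let ?c = "conf_tm s t zero"
    have 1: "\<Theta> \<turnstile> Fn pr_run [Fn pr_add [x, y], ?c] \<^bold>= halt_tm a"
      if "\<Theta> \<turnstile> Fn pr_run [y, ?c] \<^bold>= halt_tm a" for x y a
      using run_add[OF fin, of x y ?c] run_halt[OF fin, of x a] that
      by (simp add: eq_iff_nf)
    have "\<Theta> \<turnstile> halt_tm u \<^bold>= halt_tm v"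
      using 1[OF wk[OF z \<Theta>], of w] 1[OF w, of z] ap_add_commute[OF fin, of "nf \<Theta> z" "nf \<Theta> w"]
      by (simp add: eq_iff_nf)
    then show "\<Theta> \<turnstile> u \<^bold>= v"
      using fin by (blast dest: eq_pairD)
  qed
qed

text \<open>An invariant does the work: after any number of steps the configuration is one of the
  three in the cycle of \<open>step_loop\<close>, for some v. None of these is a halting
  configuration.\<close>

lemma loop_code_undefined:
  assumes fin: "finite \<Gamma>" and "\<Gamma> \<turnstile> app loop_code n u"
  shows "\<Gamma> \<turnstile> \<^bold>\<bottom>"
  using assms
proof (rule appE)
  fix \<Delta> z assume \<Delta>: "\<Gamma> \<sqsubseteq> \<Delta>" and z: "\<Delta> \<turnstile> Fn pr_run [z, conf_tm loop_code n zero] \<^bold>= halt_tm u"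
  have fin: "finite \<Delta>" using \<Delta> by (rule ext_finite)
  define run where "run s = Fn pr_run [s, conf_tm loop_code n zero]" for s
  define Inv where "Inv s = Ex (lift (run s) \<^bold>= conf_tm loop_code (Var 0) zero \<^bold>\<or>
      lift (run s) \<^bold>= conf_tm succ_code (Var 0) (loop_stack (Var 0)) \<^bold>\<or>
      lift (run s) \<^bold>= conf_tm zero (succ (Var 0)) (loop_stack (Var 0)))" for s
  have InvI: "\<Theta> \<turnstile> Inv s" if "\<Theta> \<turnstile> run s \<^bold>= conf_tm loop_code v zero \<^bold>\<or>
      run s \<^bold>= conf_tm succ_code v (loop_stack v) \<^bold>\<or>
      run s \<^bold>= conf_tm zero (succ v) (loop_stack v)" for \<Theta> s v
    using that unfolding Inv_def by (intro ExI[of _ _ v]) simp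
  have InvE: "\<Theta> \<turnstile> \<chi>" if fin: "finite \<Theta>" and "\<Theta> \<turnstile> Inv s"
    and 1: "\<And>\<Omega> v. \<Theta> \<sqsubseteq> \<Omega> \<Longrightarrow> \<Omega> \<turnstile> run s \<^bold>= conf_tm loop_code v zero \<Longrightarrow> \<Omega> \<turnstile> \<chi>"
    and 2: "\<And>\<Omega> v. \<Theta> \<sqsubseteq> \<Omega> \<Longrightarrow> \<Omega> \<turnstile> run s \<^bold>= conf_tm succ_code v (loop_stack v) \<Longrightarrow> \<Omega> \<turnstile> \<chi>"
    and 3: "\<And>\<Omega> v. \<Theta> \<sqsubseteq> \<Omega> \<Longrightarrow> \<Omega> \<turnstile> run s \<^bold>= conf_tm zero (succ v) (loop_stack v) \<Longrightarrow> \<Omega> \<turnstile> \<chi>"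
    for \<Theta> s \<chi>
    using fin that(2)[unfolded Inv_def]
  proof (rule Ex_ext, simp)
    fix \<Omega> v assume \<Omega>: "\<Theta> \<sqsubseteq> \<Omega>" and d: "\<Omega> \<turnstile> run s \<^bold>= conf_tm loop_code v zero \<^bold>\<or>
      run s \<^bold>= conf_tm succ_code v (loop_stack v) \<^bold>\<or>
      run s \<^bold>= conf_tm zero (succ v) (loop_stack v)"
    show "\<Omega> \<turnstile> \<chi>"
      using ext_finite[OF \<Omega>] d
      by (rule Or_ext) (blast intro: 1 2 3 ext_trans[OF \<Omega>] Or_ext ext_finite ext_trans)+
  qed
  have "\<Delta> \<turnstile> Inv z"
  proof -
    \<comment> \<open>The invariant as a single formula in the step count, which is
      \<open>Var 1\<close> below the quantifier over v, as the induction axiom requires.\<close>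
    define \<phi> where "\<phi> = Ex (
      Fn pr_run [Var 1, conf_tm loop_code (lift (lift n)) zero] \<^bold>= conf_tm loop_code (Var 0) zero \<^bold>\<or>
      Fn pr_run [Var 1, conf_tm loop_code (lift (lift n)) zero]
        \<^bold>= conf_tm succ_code (Var 0) (loop_stack (Var 0)) \<^bold>\<or>
      Fn pr_run [Var 1, conf_tm loop_code (lift (lift n)) zero]
        \<^bold>= conf_tm zero (succ (Var 0)) (loop_stack (Var 0)))"
    have inst: "inst s \<phi> = Inv s" for s by (simp add: \<phi>_def Inv_def run_def)
    have "\<Delta> \<turnstile> inst z \<phi>"
    proof (rule ind_ext[OF fin])
      show "\<Delta> \<turnstile> inst zero \<phi>"
        unfolding inst by (rule InvI[of _ _ n], rule OrI1) (simp add: run_def eq_iff_nf)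
    next
      fix \<Theta> s assume \<Theta>: "\<Delta> \<sqsubseteq> \<Theta>" and IH: "\<Theta> \<turnstile> inst s \<phi>"
      have step: "\<Omega> \<turnstile> run (succ s) \<^bold>= d"
        if "\<Omega> \<turnstile> run s \<^bold>= c" "\<Omega> \<turnstile> Fn pr_step [c] \<^bold>= d" for \<Omega> c d
        using that by (simp add: run_def eq_iff_nf)
      show "\<Theta> \<turnstile> inst (succ s) \<phi>"
        using IH unfolding inst
        by (rule InvE[OF ext_finite[OF \<Theta>]])
          (blast intro: InvI OrI1 OrI2 step step_loop ext_finite)+
    qed
    then show ?thesis by (simp add: inst)
  qed
  then show "\<Delta> \<turnstile> \<^bold>\<bottom>"
  proof (rule InvE[OF fin])
    have nonzero: "\<Omega> \<turnstile> \<^bold>\<bottom>" if "finite \<Omega>" and eq: "\<Omega> \<turnstile> pair (succ a) b \<^bold>= zero" for \<Omega> a b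
    proof -
      obtain z where "ap \<Omega> pr_pair [ap \<Omega> PS [nf \<Omega> a], nf \<Omega> b] = ap \<Omega> PS [z]"
        using ap_pair_S[OF \<open>finite \<Omega>\<close>] by blast
      then have "\<Omega> \<turnstile> succ z \<^bold>= zero"
        using eq by (simp add: eq_iff_nf ap_nf_args)
      then show ?thesis by (rule eq_succ_zeroD)
    qed
    have eq: "\<Omega> \<turnstile> c \<^bold>= halt_tm u" if "\<Omega> \<turnstile> run z \<^bold>= c" "\<Delta> \<sqsubseteq> \<Omega>" for \<Omega> c
      using eq_trans[OF eq_sym[OF that(1)] wk[OF z[folded run_def] that(2)]] .
    fix \<Omega> v assume \<Omega>: "\<Delta> \<sqsubseteq> \<Omega>"
    have fin: "finite \<Omega>" using \<Omega> by (rule ext_finite)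
    show "\<Omega> \<turnstile> \<^bold>\<bottom>" if "\<Omega> \<turnstile> run z \<^bold>= conf_tm loop_code v zero"
      using eq_pairD(1)[OF fin eq[OF that \<Omega>]] nonzero[OF fin] by (simp add: loop_code_def)
    show "\<Omega> \<turnstile> \<^bold>\<bottom>" if "\<Omega> \<turnstile> run z \<^bold>= conf_tm succ_code v (loop_stack v)"
      using eq_pairD(1)[OF fin eq[OF that \<Omega>]] nonzero[OF fin] by (simp add: succ_code_def)
    \<comment> \<open>Here the code component is zero, just as in a halting configuration; the
      contradiction comes from the nonempty stack.\<close>
    show "\<Omega> \<turnstile> \<^bold>\<bottom>" if "\<Omega> \<turnstile> run z \<^bold>= conf_tm zero (succ v) (loop_stack v)"
      using eq_pairD(2)[OF fin eq_pairD(2)[OF fin eq[OF that \<Omega>]]] by (rule eq_succ_zeroD)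
  qed
qed

section \<open>Statements about partial terms\<close>

lemma app_cong: "\<Gamma> \<turnstile> app s t u \<Longrightarrow> \<Gamma> \<turnstile> u \<^bold>= v \<Longrightarrow> \<Gamma> \<turnstile> app s t v"
  using eq_subst[of \<Gamma> u v "app (lift s) (lift t) (Var 0)"] by simp

lemma app_satI: "\<Gamma> \<turnstile> app s t u \<Longrightarrow> \<Gamma> \<turnstile> inst u \<phi> \<Longrightarrow> \<Gamma> \<turnstile> app_sat s t \<phi>"
  unfolding app_sat_def by (rule ExI[of _ _ u]) (simp add: AndI)

lemma app_satE:
  assumes "finite \<Gamma>" "\<Gamma> \<turnstile> app_sat s t \<phi>"
    "\<And>\<Delta> u. \<Gamma> \<sqsubseteq> \<Delta> \<Longrightarrow> \<Delta> \<turnstile> app s t u \<Longrightarrow> \<Delta> \<turnstile> inst u \<phi> \<Longrightarrow> \<Delta> \<turnstile> \<chi>"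
  shows "\<Gamma> \<turnstile> \<chi>"
  by (rule Ex_ext[OF assms(1) assms(2)[unfolded app_sat_def]])
    (simp, blast intro: assms(3) AndE1 AndE2)

lemma app_satD:
  assumes fin: "finite \<Gamma>" and "\<Gamma> \<turnstile> app_sat s t \<phi>" "\<Gamma> \<turnstile> app s t u"
  shows "\<Gamma> \<turnstile> inst u \<phi>"
  by (rule app_satE[OF assms(1,2)]) (blast intro: eq_subst app_functional ext_finite wk assms(3))

lemma defdE:
  assumes "finite \<Gamma>" "\<Gamma> \<turnstile> defd s t" "\<And>\<Delta> u. \<Gamma> \<sqsubseteq> \<Delta> \<Longrightarrow> \<Delta> \<turnstile> app s t u \<Longrightarrow> \<Delta> \<turnstile> \<chi>"
  shows "\<Gamma> \<turnstile> \<chi>"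
  by (rule Ex_ext[OF assms(1) assms(2)[unfolded defd_def]]) (simp add: assms(3))

end

section \<open>Conditions and v-sets\<close>

locale vmt =
  fixes \<xi> :: prfun
begin

sublocale ha "VMT \<xi>"
  by unfold_locales (auto intro: VMT.arith)

abbreviation vprv :: "fm set \<Rightarrow> fm \<Rightarrow> bool" (infix "\<turnstile>" 40) where
  "\<Gamma> \<turnstile> \<phi> \<equiv> proves (VMT \<xi>) \<Gamma> \<phi>"

section \<open>Total codes from ECT\<close>

text \<open>Taking 0 = 0 as the almost-negative premise makes the code total, and \<psi> remains
  arbitrary, so it may mention V, M and T.\<close>

lemma ECT_total:
  assumes fin: "finite \<Gamma>" and ex: "\<And>n. \<Gamma> \<turnstile> inst n (Ex \<psi>)"
    and cont: "\<And>\<Delta> e. \<Gamma> \<sqsubseteq> \<Delta> \<Longrightarrow> (\<And>\<Theta> n. \<Delta> \<sqsubseteq> \<Theta> \<Longrightarrow> \<Theta> \<turnstile> app_sat e n (sb (up (case_nat n Var)) \<psi>))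
      \<Longrightarrow> \<Delta> \<turnstile> \<chi>"
  shows "\<Gamma> \<turnstile> \<chi>"
proof -
  let ?\<psi> = "sb (\<lambda>i. Var (if i < 2 then i else Suc i)) \<psi>"
  have "almost_negative (zero \<^bold>= zero)"
    by (intro almost_negative.intros sigma1.intros delta0.intros)
  then have ax: "\<Gamma> \<turnstile> All (zero \<^bold>= zero \<^bold>\<longrightarrow> Ex \<psi>) \<^bold>\<longrightarrow> Ex (All (zero \<^bold>= zero \<^bold>\<longrightarrow> app_sat (Var 1) (Var 0) ?\<psi>))"
    using axm[OF VMT.ECT[of "zero \<^bold>= zero" \<psi> \<xi>]] by simp
  have "\<Gamma> \<turnstile> All (zero \<^bold>= zero \<^bold>\<longrightarrow> Ex \<psi>)"
    using fin wk[OF ex] by (auto intro!: All_terms Imp_ext)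
  then have "\<Gamma> \<turnstile> Ex (All (zero \<^bold>= zero \<^bold>\<longrightarrow> app_sat (Var 1) (Var 0) ?\<psi>))"
    by (rule ImpE[OF ax])
  with fin show ?thesis
  proof (rule Ex_ext)
    fix \<Delta> e assume \<Delta>: "\<Gamma> \<sqsubseteq> \<Delta>"
      and e: "\<Delta> \<turnstile> inst e (All (zero \<^bold>= zero \<^bold>\<longrightarrow> app_sat (Var 1) (Var 0) ?\<psi>))"
    have "\<Delta> \<turnstile> app_sat e n (sb (up (case_nat n Var)) \<psi>)" for n
    proof -
      \<comment> \<open>Instantiating \<open>e\<close> undoes the shift of the indices from 2 on;
        index 0, the value, and index 1, the argument, were never moved.\<close>
      have "sbt (up (case_nat n Var)) (sbt (up (up (case_nat e Var))) (Var (if i < 2 then i else Suc i)))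
          = up (case_nat n Var) i" for i
        by (cases i; cases "i - 1") auto
      then have "sb (up (case_nat n Var)) (sb (up (up (case_nat e Var))) ?\<psi>) = sb (up (case_nat n Var)) \<psi>"
        by (simp add: sb_sb del: sbt.simps)
      then have "\<Delta> \<turnstile> zero \<^bold>= zero \<^bold>\<longrightarrow> app_sat e n (sb (up (case_nat n Var)) \<psi>)"
        using AllE[OF e[simplified], of n] by simp
      then show ?thesis by (rule ImpE) (rule eq_refl)
    qed
    then show "\<Delta> \<turnstile> \<chi>"
      by (intro cont[OF \<Delta>]) (blast intro: wk)
  qed
qed

text \<open>The graph \<psi> of the case distinction is total by \<open>eq_dec\<close>, and
  \<open>ECT\<close> supplies a code for it. So no program has to be written and run on the
  machine.\<close>

lemma code_if_eq:
  assumes fin: "finite \<Gamma>"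
    and cont: "\<And>\<Delta> e. \<Gamma> \<sqsubseteq> \<Delta> \<Longrightarrow>
      (\<And>\<Theta> n. \<Delta> \<sqsubseteq> \<Theta> \<Longrightarrow> \<Theta> \<turnstile> inst n (s \<^bold>= t) \<Longrightarrow> \<Theta> \<turnstile> app e n u) \<Longrightarrow>
      (\<And>\<Theta> n. \<Delta> \<sqsubseteq> \<Theta> \<Longrightarrow> \<Theta> \<turnstile> Neg (inst n (s \<^bold>= t)) \<Longrightarrow> \<Theta> \<turnstile> app e n w) \<Longrightarrow> \<Delta> \<turnstile> \<chi>"
  shows "\<Gamma> \<turnstile> \<chi>"
proof -
  define D where "D = (s \<^bold>= t)"
  define \<psi> where "\<psi> = ((liftf D \<^bold>\<and> Var 0 \<^bold>= lift (lift u)) \<^bold>\<or> (Neg (liftf D) \<^bold>\<and> Var 0 \<^bold>= lift (lift w)))"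
  have \<psi>: "sb (up (case_nat n Var)) \<psi> =
      ((liftf (inst n D) \<^bold>\<and> Var 0 \<^bold>= lift u) \<^bold>\<or> (Neg (liftf (inst n D)) \<^bold>\<and> Var 0 \<^bold>= lift w))" for n
    by (simp add: \<psi>_def up_liftf)
  show ?thesis
  proof (rule ECT_total[OF fin, of \<psi>])
    fix n
    have "\<Gamma> \<turnstile> inst n D \<^bold>\<or> Neg (inst n D)"
      by (simp add: D_def eq_dec[OF fin])
    with fin show "\<Gamma> \<turnstile> inst n (Ex \<psi>)"
    proof (rule Or_ext)
      fix \<Delta> assume "\<Delta> \<turnstile> inst n D"
      then show "\<Delta> \<turnstile> inst n (Ex \<psi>)"
        by (auto simp: \<psi> intro!: ExI[of _ _ u] OrI1 AndI eq_refl)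
    next
      fix \<Delta> assume "\<Delta> \<turnstile> Neg (inst n D)"
      then show "\<Delta> \<turnstile> inst n (Ex \<psi>)"
        by (auto simp: \<psi> intro!: ExI[of _ _ w] OrI2 AndI eq_refl)
    qed
  next
    fix \<Delta> e assume \<Delta>: "\<Gamma> \<sqsubseteq> \<Delta>"
      and e: "\<And>\<Theta> n. \<Delta> \<sqsubseteq> \<Theta> \<Longrightarrow> \<Theta> \<turnstile> app_sat e n (sb (up (case_nat n Var)) \<psi>)"
    have cases: "\<Theta> \<turnstile> \<theta>" if \<Theta>: "\<Delta> \<sqsubseteq> \<Theta>"
      and 1: "\<And>\<Omega>. \<Theta> \<sqsubseteq> \<Omega> \<Longrightarrow> \<Omega> \<turnstile> inst n D \<Longrightarrow> \<Omega> \<turnstile> app e n u \<Longrightarrow> \<Omega> \<turnstile> \<theta>"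
      and 2: "\<And>\<Omega>. \<Theta> \<sqsubseteq> \<Omega> \<Longrightarrow> \<Omega> \<turnstile> Neg (inst n D) \<Longrightarrow> \<Omega> \<turnstile> app e n w \<Longrightarrow> \<Omega> \<turnstile> \<theta>" for \<Theta> n \<theta>
      using ext_finite[OF \<Theta>] e[OF \<Theta>, of n, unfolded \<psi>]
    proof (rule app_satE)
      fix \<Omega> m assume \<Omega>: "\<Theta> \<sqsubseteq> \<Omega>" and m: "\<Omega> \<turnstile> app e n m"
        and "\<Omega> \<turnstile> inst m ((liftf (inst n D) \<^bold>\<and> Var 0 \<^bold>= lift u) \<^bold>\<or> (Neg (liftf (inst n D)) \<^bold>\<and> Var 0 \<^bold>= lift w))"
      then have "\<Omega> \<turnstile> (inst n D \<^bold>\<and> m \<^bold>= u) \<^bold>\<or> (Neg (inst n D) \<^bold>\<and> m \<^bold>= w)" by simp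
      with ext_finite[OF \<Omega>] show "\<Omega> \<turnstile> \<theta>"
        by (rule Or_ext) (meson 1 2 AndE1 AndE2 app_cong wk m \<Omega> ext_trans)+
    qed
    show "\<Delta> \<turnstile> \<chi>"
    proof (rule cont[OF \<Delta>, folded D_def])
      fix \<Theta> n assume \<Theta>: "\<Delta> \<sqsubseteq> \<Theta>"
      show "\<Theta> \<turnstile> app e n u" if "\<Theta> \<turnstile> inst n D"
        by (rule cases[OF \<Theta>]) (blast intro: FlsE ImpE wk that)+
      show "\<Theta> \<turnstile> app e n w" if "\<Theta> \<turnstile> Neg (inst n D)"
        by (rule cases[OF \<Theta>]) (blast intro: FlsE ImpE wk that)+
    qed
  qed
qed

lemma code_const:
  assumes fin: "finite \<Gamma>"
    and cont: "\<And>\<Delta> e. \<Gamma> \<sqsubseteq> \<Delta> \<Longrightarrow> (\<And>\<Theta> n. \<Delta> \<sqsubseteq> \<Theta> \<Longrightarrow> \<Theta> \<turnstile> app e n u) \<Longrightarrow> \<Delta> \<turnstile> \<chi>"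
  shows "\<Gamma> \<turnstile> \<chi>"
  by (rule code_if_eq[OF fin, of zero zero u zero]) (rule cont, assumption, simp add: eq_refl)

section \<open>Meaning and truth of conditions formed with \<Xi>\<close>

lemma PM_XiI:
  assumes fin: "finite \<Gamma>"
    and 1: "\<And>\<Delta> n u. \<Gamma> \<sqsubseteq> \<Delta> \<Longrightarrow> \<Delta> \<turnstile> app f n u \<Longrightarrow> \<Delta> \<turnstile> PM u"
    and 2: "\<And>\<Delta> n u v. \<Gamma> \<sqsubseteq> \<Delta> \<Longrightarrow> \<Delta> \<turnstile> app f n u \<Longrightarrow> \<Delta> \<turnstile> PT u \<Longrightarrow> \<Delta> \<turnstile> app g n v \<Longrightarrow> \<Delta> \<turnstile> PM v"
  shows "\<Gamma> \<turnstile> PM (Fn \<xi> [f, g])"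
proof (rule ImpE[OF axm[OF VMT.X2]], rule AndI)
  have "\<Delta> \<turnstile> app_sat f n (PM (Var 0))" if \<Delta>: "\<Gamma> \<sqsubseteq> \<Delta>" and "\<Delta> \<turnstile> defd f n" for \<Delta> n
    by (rule defdE[OF ext_finite[OF \<Delta>] that(2)])
      (rule app_satI, assumption, simp, blast intro: 1 ext_trans[OF \<Delta>])
  then show "\<Gamma> \<turnstile> All (defd (lift f) (Var 0) \<^bold>\<longrightarrow> app_sat (lift f) (Var 0) (PM (Var 0)))"
    using fin by (auto intro!: All_terms Imp_ext)
  have "\<Delta> \<turnstile> app_sat g n (PM (Var 0))"
    if \<Delta>: "\<Gamma> \<sqsubseteq> \<Delta>" and h: "\<Delta> \<turnstile> defd f n \<^bold>\<and> defd g n \<^bold>\<and> app_sat f n (PT (Var 0))" for \<Delta> n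
    using ext_finite[OF \<Delta>] AndE1[OF AndE2[OF h]]
  proof (rule defdE)
    fix \<Theta> v assume \<Theta>: "\<Delta> \<sqsubseteq> \<Theta>" and v: "\<Theta> \<turnstile> app g n v"
    show "\<Theta> \<turnstile> app_sat g n (PM (Var 0))"
      using ext_finite[OF \<Theta>] wk[OF AndE2[OF AndE2[OF h]] \<Theta>]
    proof (rule app_satE)
      fix \<Omega> u assume \<Omega>: "\<Theta> \<sqsubseteq> \<Omega>" and "\<Omega> \<turnstile> app f n u" "\<Omega> \<turnstile> inst u (PT (Var 0))"
      then have "\<Omega> \<turnstile> PM v"
        by (intro 2[OF ext_trans[OF ext_trans[OF \<Delta> \<Theta>] \<Omega>], of n u]) (auto intro: wk[OF v])
      then show "\<Omega> \<turnstile> app_sat g n (PM (Var 0))"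
        by (intro app_satI[OF wk[OF v \<Omega>]]) simp
    qed
  qed
  then show "\<Gamma> \<turnstile> All (defd (lift f) (Var 0) \<^bold>\<and> defd (lift g) (Var 0) \<^bold>\<and> app_sat (lift f) (Var 0) (PT (Var 0))
      \<^bold>\<longrightarrow> app_sat (lift g) (Var 0) (PM (Var 0)))"
    using fin by (auto intro!: All_terms Imp_ext)
qed

lemma PT_XiI:
  assumes fin: "finite \<Gamma>" and M: "\<Gamma> \<turnstile> PM (Fn \<xi> [f, g])"
    and *: "\<And>\<Delta> n u. \<Gamma> \<sqsubseteq> \<Delta> \<Longrightarrow> \<Delta> \<turnstile> app f n u \<Longrightarrow> \<Delta> \<turnstile> PT u \<Longrightarrow> \<Delta> \<turnstile> app_sat g n (PT (Var 0))"
  shows "\<Gamma> \<turnstile> PT (Fn \<xi> [f, g])"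
proof (rule ImpE[OF AndE2[OF ImpE[OF axm[OF VMT.X1] M]]])
  have "\<Delta> \<turnstile> app_sat g n (PT (Var 0))"
    if \<Delta>: "\<Gamma> \<sqsubseteq> \<Delta>" and h: "\<Delta> \<turnstile> app_sat f n (PT (Var 0))" for \<Delta> n
  proof (rule app_satE[OF ext_finite[OF \<Delta>] h])
    fix \<Theta> u assume \<Theta>: "\<Delta> \<sqsubseteq> \<Theta>" and "\<Theta> \<turnstile> app f n u" "\<Theta> \<turnstile> inst u (PT (Var 0))"
    then show "\<Theta> \<turnstile> app_sat g n (PT (Var 0))"
      by (intro *[OF ext_trans[OF \<Delta> \<Theta>]]) auto
  qed
  then show "\<Gamma> \<turnstile> All (app_sat (lift f) (Var 0) (PT (Var 0)) \<^bold>\<longrightarrow> app_sat (lift g) (Var 0) (PT (Var 0)))"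
    using fin by (auto intro!: All_terms Imp_ext)
qed

lemma PT_XiD:
  assumes "\<Gamma> \<turnstile> PM (Fn \<xi> [f, g])" "\<Gamma> \<turnstile> PT (Fn \<xi> [f, g])" "\<Gamma> \<turnstile> app f n u" "\<Gamma> \<turnstile> PT u"
  shows "\<Gamma> \<turnstile> app_sat g n (PT (Var 0))"
proof -
  have "\<Gamma> \<turnstile> All (app_sat (lift f) (Var 0) (PT (Var 0)) \<^bold>\<longrightarrow> app_sat (lift g) (Var 0) (PT (Var 0)))"
    by (rule ImpE[OF AndE1[OF ImpE[OF axm[OF VMT.X1] assms(1)]] assms(2)])
  from AllE[OF this, of n] have "\<Gamma> \<turnstile> app_sat f n (PT (Var 0)) \<^bold>\<longrightarrow> app_sat g n (PT (Var 0))"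
    by simp
  then show ?thesis
    by (rule ImpE) (rule app_satI[OF assms(3)], simp add: assms(4))
qed

lemma P_cong:
  assumes "\<Gamma> \<turnstile> s \<^bold>= t"
  shows "\<Gamma> \<turnstile> PM s \<Longrightarrow> \<Gamma> \<turnstile> PM t" "\<Gamma> \<turnstile> PT s \<Longrightarrow> \<Gamma> \<turnstile> PT t" "\<Gamma> \<turnstile> PV s \<Longrightarrow> \<Gamma> \<turnstile> PV t"
  using eq_subst[OF assms, of "PM (Var 0)"] eq_subst[OF assms, of "PT (Var 0)"]
    eq_subst[OF assms, of "PV (Var 0)"] by simp_all

lemma NegD: "\<Gamma> \<turnstile> Neg \<phi> \<Longrightarrow> \<Gamma> \<turnstile> \<phi> \<Longrightarrow> \<Gamma> \<turnstile> \<psi>"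
  by (meson FlsE ImpE)

text \<open>With the divergent code as f, the premises of \<open>X2\<close> and the statement in
  \<open>X1\<close> hold vacuously, which makes the first condition meaningful and true. Putting it
  constantly on the left, with the divergent code on the right, gives a condition that demands a
  value where there is none.\<close>

lemma true_false_conditions:
  assumes fin: "finite \<Gamma>"
    and cont: "\<And>\<Delta> a b. \<Gamma> \<sqsubseteq> \<Delta> \<Longrightarrow> \<Delta> \<turnstile> PM a \<Longrightarrow> \<Delta> \<turnstile> PT a \<Longrightarrow> \<Delta> \<turnstile> PM b \<Longrightarrow> \<Delta> \<turnstile> Neg (PT b)
      \<Longrightarrow> \<Delta> \<turnstile> \<chi>"
  shows "\<Gamma> \<turnstile> \<chi>"
proof -
  let ?a = "Fn \<xi> [loop_code, loop_code]"
  have M: "\<Gamma> \<turnstile> PM ?a"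
    by (rule PM_XiI[OF fin]) (blast intro: FlsE loop_code_undefined ext_finite)+
  have T: "\<Gamma> \<turnstile> PT ?a"
    by (rule PT_XiI[OF fin M]) (blast intro: FlsE loop_code_undefined ext_finite)
  show ?thesis
  proof (rule code_const[OF fin, of ?a])
    fix \<Delta> k assume \<Delta>: "\<Gamma> \<sqsubseteq> \<Delta>" and k: "\<And>\<Theta> n. \<Delta> \<sqsubseteq> \<Theta> \<Longrightarrow> \<Theta> \<turnstile> app k n ?a"
    let ?b = "Fn \<xi> [k, loop_code]"
    have Mb: "\<Delta> \<turnstile> PM ?b"
    proof (rule PM_XiI)
      show "finite \<Delta>" using \<Delta> by (rule ext_finite)
      fix \<Theta> n u assume \<Theta>: "\<Delta> \<sqsubseteq> \<Theta>" and "\<Theta> \<turnstile> app k n u"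
      then have "\<Theta> \<turnstile> ?a \<^bold>= u" using app_functional[OF ext_finite[OF \<Theta>] k[OF \<Theta>]] by blast
      then show "\<Theta> \<turnstile> PM u"
        by (rule P_cong) (blast intro: wk M \<Delta> \<Theta>)
    qed (blast intro: FlsE loop_code_undefined ext_finite)
    show "\<Delta> \<turnstile> \<chi>"
    proof (rule cont[OF \<Delta> _ _ Mb])
      show "\<Delta> \<turnstile> Neg (PT ?b)"
      proof (rule Imp_ext)
        show "finite \<Delta>" using \<Delta> by (rule ext_finite)
        fix \<Theta> assume \<Theta>: "\<Delta> \<sqsubseteq> \<Theta>" and "\<Theta> \<turnstile> PT ?b"
        \<comment> \<open>Zero stands for any argument: the left code has the true value
          \<open>?a\<close> everywhere, the right one has no value at all.\<close>
        then have "\<Theta> \<turnstile> app_sat loop_code zero (PT (Var 0))"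
          by (intro PT_XiD[of _ k _ _ ?a]) (blast intro: wk Mb T k \<Delta> \<Theta>)+
        with ext_finite[OF \<Theta>] show "\<Theta> \<turnstile> \<^bold>\<bottom>"
          by (rule app_satE) (blast intro: loop_code_undefined ext_finite)
      qed
    qed (blast intro: wk M T \<Delta>)+
  qed
qed

text \<open>With a constantly true left code, truth of \<Xi>(k, g) says that every value of g is
  true. The code g returns the false condition b where the equation holds and the true condition a
  elsewhere.\<close>

lemma universal_condition:
  assumes fin: "finite \<Gamma>"
    and cont: "\<And>\<Delta> p. \<Gamma> \<sqsubseteq> \<Delta> \<Longrightarrow> \<Delta> \<turnstile> PM p \<Longrightarrow> \<Delta> \<turnstile> PT p \<^bold>\<longrightarrow> All (Neg (s \<^bold>= t)) \<Longrightarrow>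
      \<Delta> \<turnstile> All (Neg (s \<^bold>= t)) \<^bold>\<longrightarrow> PT p \<Longrightarrow> \<Delta> \<turnstile> \<chi>"
  shows "\<Gamma> \<turnstile> \<chi>"
proof (rule true_false_conditions[OF fin])
  fix \<Gamma>\<^sub>1 a b assume \<Gamma>\<^sub>1: "\<Gamma> \<sqsubseteq> \<Gamma>\<^sub>1" and Ma: "\<Gamma>\<^sub>1 \<turnstile> PM a" and Ta: "\<Gamma>\<^sub>1 \<turnstile> PT a"
    and Mb: "\<Gamma>\<^sub>1 \<turnstile> PM b" and Fb: "\<Gamma>\<^sub>1 \<turnstile> Neg (PT b)"
  show "\<Gamma>\<^sub>1 \<turnstile> \<chi>"
  proof (rule code_const[OF ext_finite[OF \<Gamma>\<^sub>1], of a])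
    fix \<Gamma>\<^sub>2 k assume \<Gamma>\<^sub>2: "\<Gamma>\<^sub>1 \<sqsubseteq> \<Gamma>\<^sub>2" and k: "\<And>\<Theta> n. \<Gamma>\<^sub>2 \<sqsubseteq> \<Theta> \<Longrightarrow> \<Theta> \<turnstile> app k n a"
    show "\<Gamma>\<^sub>2 \<turnstile> \<chi>"
    proof (rule code_if_eq[OF ext_finite[OF \<Gamma>\<^sub>2], of s t b a])
      fix \<Delta> g assume \<Delta>: "\<Gamma>\<^sub>2 \<sqsubseteq> \<Delta>"
        and g1: "\<And>\<Theta> n. \<Delta> \<sqsubseteq> \<Theta> \<Longrightarrow> \<Theta> \<turnstile> inst n (s \<^bold>= t) \<Longrightarrow> \<Theta> \<turnstile> app g n b"
        and g2: "\<And>\<Theta> n. \<Delta> \<sqsubseteq> \<Theta> \<Longrightarrow> \<Theta> \<turnstile> Neg (inst n (s \<^bold>= t)) \<Longrightarrow> \<Theta> \<turnstile> app g n a"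
      have fin: "finite \<Delta>" using \<Delta> by (rule ext_finite)
      have facts: "\<Theta> \<turnstile> app k n a" "\<Theta> \<turnstile> PM a" "\<Theta> \<turnstile> PT a" "\<Theta> \<turnstile> PM b" "\<Theta> \<turnstile> Neg (PT b)"
        if "\<Delta> \<sqsubseteq> \<Theta>" for \<Theta> n
        using that by (meson k wk Ma Ta Mb Fb \<Gamma>\<^sub>2 \<Delta> ext_trans)+
      let ?p = "Fn \<xi> [k, g]"
      have M: "\<Delta> \<turnstile> PM ?p"
      proof (rule PM_XiI[OF fin])
        fix \<Theta> n u assume \<Theta>: "\<Delta> \<sqsubseteq> \<Theta>" and "\<Theta> \<turnstile> app k n u"
        then show "\<Theta> \<turnstile> PM u"
          by (meson P_cong(1) app_functional ext_finite facts(1,2))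
      next
        fix \<Theta> n v assume \<Theta>: "\<Delta> \<sqsubseteq> \<Theta>" and v: "\<Theta> \<turnstile> app g n v"
        \<comment> \<open>\<open>X2\<close> asks for meaningful values of g; deciding the equation
          tells whether the value is b or a.\<close>
        have "\<Theta> \<turnstile> inst n (s \<^bold>= t) \<^bold>\<or> Neg (inst n (s \<^bold>= t))"
          by (simp add: eq_dec[OF ext_finite[OF \<Theta>]])
        with ext_finite[OF \<Theta>] show "\<Theta> \<turnstile> PM v"
        proof (rule Or_ext)
          fix \<Omega> assume \<Omega>: "\<Theta> \<sqsubseteq> \<Omega>" and "\<Omega> \<turnstile> inst n (s \<^bold>= t)"
          then have "\<Omega> \<turnstile> b \<^bold>= v"
            by (meson app_functional ext_finite ext_trans g1 wk v \<Theta>)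
          then show "\<Omega> \<turnstile> PM v" by (rule P_cong) (meson ext_trans facts \<Theta> \<Omega>)
        next
          fix \<Omega> assume \<Omega>: "\<Theta> \<sqsubseteq> \<Omega>" and "\<Omega> \<turnstile> Neg (inst n (s \<^bold>= t))"
          then have "\<Omega> \<turnstile> a \<^bold>= v"
            by (meson app_functional ext_finite ext_trans g2 wk v \<Theta>)
          then show "\<Omega> \<turnstile> PM v" by (rule P_cong) (meson ext_trans facts \<Theta> \<Omega>)
        qed
      qed
      show "\<Delta> \<turnstile> \<chi>"
      proof (rule cont[OF _ M])
        show "\<Gamma> \<sqsubseteq> \<Delta>" by (meson ext_trans \<Gamma>\<^sub>1 \<Gamma>\<^sub>2 \<Delta>)
        show "\<Delta> \<turnstile> PT ?p \<^bold>\<longrightarrow> All (Neg (s \<^bold>= t))"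
        proof (rule Imp_ext[OF fin])
          fix \<Theta> assume \<Theta>: "\<Delta> \<sqsubseteq> \<Theta>" and T: "\<Theta> \<turnstile> PT ?p"
          have "\<Omega> \<turnstile> \<^bold>\<bottom>" if \<Omega>: "\<Theta> \<sqsubseteq> \<Omega>" and h: "\<Omega> \<turnstile> inst n (s \<^bold>= t)" for \<Omega> n
          proof -
            have \<Delta>\<Omega>: "\<Delta> \<sqsubseteq> \<Omega>" using \<Theta> \<Omega> by (rule ext_trans)
            have "\<Omega> \<turnstile> app_sat g n (PT (Var 0))"
              by (rule PT_XiD[of _ k _ _ a]) (meson wk M T \<Delta>\<Omega> \<Omega> facts)+
            from app_satD[OF ext_finite[OF \<Omega>] this g1[OF \<Delta>\<Omega> h]] have "\<Omega> \<turnstile> PT b" by simp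
            then show ?thesis using facts(5)[OF \<Delta>\<Omega>] NegD by blast
          qed
          then show "\<Theta> \<turnstile> All (Neg (s \<^bold>= t))"
            using ext_finite[OF \<Theta>] by (auto intro!: All_terms Imp_ext)
        qed
        show "\<Delta> \<turnstile> All (Neg (s \<^bold>= t)) \<^bold>\<longrightarrow> PT ?p"
        proof (rule Imp_ext[OF fin])
          fix \<Theta> assume \<Theta>: "\<Delta> \<sqsubseteq> \<Theta>" and h: "\<Theta> \<turnstile> All (Neg (s \<^bold>= t))"
          show "\<Theta> \<turnstile> PT ?p"
          proof (rule PT_XiI[OF ext_finite[OF \<Theta>] wk[OF M \<Theta>]])
            fix \<Omega> n assume \<Omega>: "\<Theta> \<sqsubseteq> \<Omega>"
            have \<Delta>\<Omega>: "\<Delta> \<sqsubseteq> \<Omega>" using \<Theta> \<Omega> by (rule ext_trans)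
            have "\<Omega> \<turnstile> Neg (inst n (s \<^bold>= t))" using AllE[OF wk[OF h \<Omega>], of n] by simp
            from app_satI[OF g2[OF \<Delta>\<Omega> this]] show "\<Omega> \<turnstile> app_sat g n (PT (Var 0))"
              using facts(3)[OF \<Delta>\<Omega>] by simp
          qed
        qed
      qed
    qed
  qed
qed

section \<open>Building v-sets and reading off their elements\<close>

lemma PV_I:
  assumes fin: "finite \<Gamma>"
    and *: "\<And>\<Delta> n. \<Gamma> \<sqsubseteq> \<Delta> \<Longrightarrow>
      \<Delta> \<turnstile> app_sat x n (PM (rgt (Var 0)) \<^bold>\<and> (PT (rgt (Var 0)) \<^bold>\<longrightarrow> PV (lft (Var 0))))"
  shows "\<Gamma> \<turnstile> PV x"
proof -
  have "\<Gamma> \<turnstile> inst x (vclosed (PV (Var 0)) \<^bold>\<longrightarrow> PV (Var 0))"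
    by (rule AllE[OF axm[OF VMT.V1]])
  moreover have "\<Gamma> \<turnstile> inst x (vclosed (PV (Var 0)))"
    using fin * by (auto simp: vclosed_def ext_refl intro!: All_terms)
  ultimately show ?thesis by (auto intro: ImpE)
qed

text \<open>The entry has to be a v-set only under its condition, so a false condition may guard any
  number. This is how the empty set gets a total code.\<close>

lemma vset_entryI:
  assumes fin: "finite \<Gamma>" and "\<Gamma> \<turnstile> app x n (pair a c)" and M: "\<Gamma> \<turnstile> PM c"
    and V: "\<Gamma> \<turnstile> PT c \<^bold>\<longrightarrow> PV a"
  shows "\<Gamma> \<turnstile> app_sat x n (PM (rgt (Var 0)) \<^bold>\<and> (PT (rgt (Var 0)) \<^bold>\<longrightarrow> PV (lft (Var 0))))"
proof (rule app_satI[OF assms(2)])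
  have eq: "\<Delta> \<turnstile> rgt (pair a c) \<^bold>= c" "\<Delta> \<turnstile> lft (pair a c) \<^bold>= a" if "finite \<Delta>" for \<Delta>
    using that by (simp_all add: eq_iff_nf)
  have "\<Gamma> \<turnstile> PM (rgt (pair a c))"
    using P_cong(1)[OF eq_sym[OF eq(1)]] fin M by blast
  moreover have "\<Gamma> \<turnstile> PT (rgt (pair a c)) \<^bold>\<longrightarrow> PV (lft (pair a c))"
  proof (rule Imp_ext[OF fin])
    fix \<Delta> assume \<Delta>: "\<Gamma> \<sqsubseteq> \<Delta>" and "\<Delta> \<turnstile> PT (rgt (pair a c))"
    then have "\<Delta> \<turnstile> PT c" using P_cong(2)[OF eq(1)] ext_finite by blast
    then have "\<Delta> \<turnstile> PV a" using ImpE wk V \<Delta> by blast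
    then show "\<Delta> \<turnstile> PV (lft (pair a c))"
      using P_cong(3)[OF eq_sym[OF eq(2)]] ext_finite \<Delta> by blast
  qed
  ultimately show "\<Gamma> \<turnstile> inst (pair a c) (PM (rgt (Var 0)) \<^bold>\<and> (PT (rgt (Var 0)) \<^bold>\<longrightarrow> PV (lft (Var 0))))"
    by (simp add: AndI)
qed

lemma inEL_I:
  assumes fin: "finite \<Gamma>" and "\<Gamma> \<turnstile> app x n (pair a c)" and T: "\<Gamma> \<turnstile> PT c"
  shows "\<Gamma> \<turnstile> inEL a x"
proof -
  have "\<Gamma> \<turnstile> PT (rgt (pair a c))"
    by (rule P_cong(2)[OF _ T]) (simp add: eq_iff_nf fin)
  moreover have "\<Gamma> \<turnstile> a \<^bold>= lft (pair a c)" by (simp add: eq_iff_nf fin)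
  ultimately have "\<Gamma> \<turnstile> app_sat x n (PT (rgt (Var 0)) \<^bold>\<and> lift a \<^bold>= lft (Var 0))"
    by (intro app_satI[OF assms(2)]) (simp add: AndI)
  then show ?thesis
    unfolding inEL_def by (intro ExI[of _ _ n]) simp
qed

lemma inEL_E:
  assumes fin: "finite \<Gamma>" and "\<Gamma> \<turnstile> inEL a x"
    and *: "\<And>\<Delta> n v. \<Gamma> \<sqsubseteq> \<Delta> \<Longrightarrow> \<Delta> \<turnstile> app x n v \<Longrightarrow> \<Delta> \<turnstile> PT (rgt v) \<Longrightarrow> \<Delta> \<turnstile> a \<^bold>= lft v \<Longrightarrow> \<Delta> \<turnstile> \<chi>"
  shows "\<Gamma> \<turnstile> \<chi>"
proof (rule Ex_ext[OF fin assms(2)[unfolded inEL_def]], simp)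
  fix \<Delta> n assume \<Delta>: "\<Gamma> \<sqsubseteq> \<Delta>"
    and h: "\<Delta> \<turnstile> app_sat x n (PT (rgt (Var 0)) \<^bold>\<and> lift a \<^bold>= lft (Var 0))"
  show "\<Delta> \<turnstile> \<chi>"
    by (rule app_satE[OF ext_finite[OF \<Delta>] h]) (simp, meson * AndE1 AndE2 ext_trans \<Delta>)
qed

lemma inEL_pairD:
  assumes fin: "finite \<Gamma>" and "\<Gamma> \<turnstile> app x n v" "\<Gamma> \<turnstile> PT (rgt v)" "\<Gamma> \<turnstile> s \<^bold>= lft v"
    "\<Gamma> \<turnstile> app x n (pair a c)"
  shows "\<Gamma> \<turnstile> s \<^bold>= a" "\<Gamma> \<turnstile> PT c"
proof -
  have v: "\<Gamma> \<turnstile> v \<^bold>= pair a c" using app_functional[OF fin assms(2,5)] .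
  then show "\<Gamma> \<turnstile> s \<^bold>= a" using assms(4) fin by (simp add: eq_iff_nf)
  show "\<Gamma> \<turnstile> PT c"
    by (rule P_cong(2)[OF _ assms(3)]) (use v fin in \<open>simp add: eq_iff_nf\<close>)
qed

end

section \<open>Foundation decides all conditions\<close>

context vmt
begin

text \<open>For x = y both halves of the characterization become the same formula, with each element
  as its own counterpart. This is applied to \<emptyset> and {\<emptyset>}, where reflexivity at the
  elements is at hand.\<close>

lemma rel2_refl:
  assumes fin: "finite \<Gamma>" and E: "{} \<turnstile> ext_equality E" and V: "\<Gamma> \<turnstile> PV x"
    and *: "\<And>\<Delta> a. \<Gamma> \<sqsubseteq> \<Delta> \<Longrightarrow> \<Delta> \<turnstile> inEL a x \<Longrightarrow> \<Delta> \<turnstile> rel2 E a a"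
  shows "\<Gamma> \<turnstile> rel2 E x x"
proof -
  let ?A = "All (inEL (Var 0) (lift x) \<^bold>\<longrightarrow>
    Ex (inEL (Var 0) (lift (lift x)) \<^bold>\<and> rel2 E (Var 1) (Var 0)))"
  have "\<Gamma> \<turnstile> ext_equality E" using wk[OF E] fin by (simp add: ext_def)
  from AllE[OF AllE[OF this[unfolded ext_equality_def], of x, simplified], of x]
  have "\<Gamma> \<turnstile> PV x \<^bold>\<and> PV x \<^bold>\<longrightarrow> (rel2 E x x \<^bold>\<longleftrightarrow> ?A \<^bold>\<and> ?A)" by simp
  then have "\<Gamma> \<turnstile> ?A \<^bold>\<and> ?A \<^bold>\<longrightarrow> rel2 E x x"
    using V by (blast intro: ImpE AndI AndE2)
  moreover have "\<Gamma> \<turnstile> ?A"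
  proof (rule All_terms[OF fin], simp, rule Imp_ext[OF fin])
    fix a \<Delta> assume \<Delta>: "\<Gamma> \<sqsubseteq> \<Delta>" "\<Delta> \<turnstile> inEL a x"
    then show "\<Delta> \<turnstile> Ex (inEL (Var 0) (lift x) \<^bold>\<and> rel2 E (lift a) (Var 0))"
      by (intro ExI[of _ _ a]) (simp add: AndI *)
  qed
  ultimately show ?thesis by (blast intro: ImpE AndI)
qed

text \<open>The witness y comes from a bounded quantifier and so lies in \<open>EL\<close> of x
  itself. Membership in the disjointness clause is only up to extensional equality; reflexivity at z
  turns \<open>inEL\<close> into it.\<close>

lemma foundationD:
  assumes fin: "finite \<Gamma>" and F: "\<Gamma> \<turnstile> interp E foundation" and V: "\<Gamma> \<turnstile> PV x"
    and w: "\<Gamma> \<turnstile> inEL w x" "\<Gamma> \<turnstile> PV w" "\<Gamma> \<turnstile> rel2 E w w"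
    and cont: "\<And>\<Delta> y. \<Gamma> \<sqsubseteq> \<Delta> \<Longrightarrow> \<Delta> \<turnstile> inEL y x \<Longrightarrow>
      (\<And>\<Theta> z. \<Delta> \<sqsubseteq> \<Theta> \<Longrightarrow> \<Theta> \<turnstile> PV z \<Longrightarrow> \<Theta> \<turnstile> rel2 E z z \<Longrightarrow> \<Theta> \<turnstile> inEL z y \<Longrightarrow> \<Theta> \<turnstile> inEL z x \<Longrightarrow> \<Theta> \<turnstile> \<^bold>\<bottom>)
      \<Longrightarrow> \<Delta> \<turnstile> \<chi>"
  shows "\<Gamma> \<turnstile> \<chi>"
proof -
  let ?mem = "\<lambda>z y. Ex (inEL (Var 0) (lift y) \<^bold>\<and> rel2 E (lift z) (Var 0))"
  have memI: "\<Theta> \<turnstile> ?mem z y" if "\<Theta> \<turnstile> rel2 E z z" "\<Theta> \<turnstile> inEL z y" for \<Theta> z y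
    using that by (intro ExI[of _ _ z]) (simp add: AndI)
  have "\<Gamma> \<turnstile> PV x \<^bold>\<longrightarrow> Ex (PV (Var 0) \<^bold>\<and> ?mem (Var 0) (lift x)) \<^bold>\<longrightarrow>
      Ex (inEL (Var 0) (lift x) \<^bold>\<and>
        All (PV (Var 0) \<^bold>\<longrightarrow> Neg (?mem (Var 0) (Var 1) \<^bold>\<and> ?mem (Var 0) (lift (lift x)))))"
    using AllE[OF F[unfolded foundation_def interp.simps], of x]
    by (simp add: inhabited_def disjoint_sets_def numeral_eq_Suc)
  moreover have "\<Gamma> \<turnstile> Ex (PV (Var 0) \<^bold>\<and> ?mem (Var 0) (lift x))"
    by (rule ExI[of _ _ w]) (simp add: AndI w memI)
  ultimately have "\<Gamma> \<turnstile> Ex (inEL (Var 0) (lift x) \<^bold>\<and>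
        All (PV (Var 0) \<^bold>\<longrightarrow> Neg (?mem (Var 0) (Var 1) \<^bold>\<and> ?mem (Var 0) (lift (lift x)))))"
    using V by (blast intro: ImpE)
  with fin show ?thesis
  proof (rule Ex_ext)
    fix \<Delta> y assume \<Delta>: "\<Gamma> \<sqsubseteq> \<Delta>"
      and "\<Delta> \<turnstile> inst y (inEL (Var 0) (lift x) \<^bold>\<and>
        All (PV (Var 0) \<^bold>\<longrightarrow> Neg (?mem (Var 0) (Var 1) \<^bold>\<and> ?mem (Var 0) (lift (lift x)))))"
    then have y: "\<Delta> \<turnstile> inEL y x \<^bold>\<and> All (PV (Var 0) \<^bold>\<longrightarrow> Neg (?mem (Var 0) (lift y) \<^bold>\<and> ?mem (Var 0) (lift x)))"
      by simp
    show "\<Delta> \<turnstile> \<chi>"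
    proof (rule cont[OF \<Delta> AndE1[OF y]])
      fix \<Theta> z assume \<Theta>: "\<Delta> \<sqsubseteq> \<Theta>"
        and z: "\<Theta> \<turnstile> PV z" "\<Theta> \<turnstile> rel2 E z z" "\<Theta> \<turnstile> inEL z y" "\<Theta> \<turnstile> inEL z x"
      have "\<Theta> \<turnstile> PV z \<^bold>\<longrightarrow> Neg (?mem z y \<^bold>\<and> ?mem z x)"
        using AllE[OF wk[OF AndE2[OF y] \<Theta>], of z] by simp
      then show "\<Theta> \<turnstile> \<^bold>\<bottom>"
        by (rule ImpE[OF ImpE[OF _ z(1)]]) (intro AndI memI z)
    qed
  qed
qed

text \<open>Foundation is applied to \<open>{\<emptyset> | p} \<union> {{\<emptyset>}}\<close>.\<close>

lemma condition_dec:
  assumes fin: "finite \<Gamma>" and E: "{} \<turnstile> ext_equality E" and F: "\<Gamma> \<turnstile> interp E foundation"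
    and M: "\<Gamma> \<turnstile> PM p"
  shows "\<Gamma> \<turnstile> PT p \<^bold>\<or> Neg (PT p)"
proof (rule true_false_conditions[OF fin])
  fix \<Gamma>\<^sub>1 a b assume \<Gamma>\<^sub>1: "\<Gamma> \<sqsubseteq> \<Gamma>\<^sub>1" and Ma: "\<Gamma>\<^sub>1 \<turnstile> PM a" and Ta: "\<Gamma>\<^sub>1 \<turnstile> PT a"
    and Mb: "\<Gamma>\<^sub>1 \<turnstile> PM b" and Fb: "\<Gamma>\<^sub>1 \<turnstile> Neg (PT b)"
  show "\<Gamma>\<^sub>1 \<turnstile> PT p \<^bold>\<or> Neg (PT p)"
  \<comment> \<open>All entries are guarded by the false condition, so \<open>e0\<close> codes
    \<emptyset>; \<open>e1\<close> below, with the true condition on every entry, codes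
    {\<emptyset>}.\<close>
  proof (rule code_const[OF ext_finite[OF \<Gamma>\<^sub>1], of "pair zero b"])
    fix \<Gamma>\<^sub>2 e0 assume \<Gamma>\<^sub>2: "\<Gamma>\<^sub>1 \<sqsubseteq> \<Gamma>\<^sub>2" and e0: "\<And>\<Theta> n. \<Gamma>\<^sub>2 \<sqsubseteq> \<Theta> \<Longrightarrow> \<Theta> \<turnstile> app e0 n (pair zero b)"
    show "\<Gamma>\<^sub>2 \<turnstile> PT p \<^bold>\<or> Neg (PT p)"
    proof (rule code_const[OF ext_finite[OF \<Gamma>\<^sub>2], of "pair e0 a"])
      fix \<Gamma>\<^sub>3 e1 assume \<Gamma>\<^sub>3: "\<Gamma>\<^sub>2 \<sqsubseteq> \<Gamma>\<^sub>3" and e1: "\<And>\<Theta> n. \<Gamma>\<^sub>3 \<sqsubseteq> \<Theta> \<Longrightarrow> \<Theta> \<turnstile> app e1 n (pair e0 a)"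
      show "\<Gamma>\<^sub>3 \<turnstile> PT p \<^bold>\<or> Neg (PT p)"
      \<comment> \<open>Entry 0 is \<emptyset> under the condition p, every other entry is
        {\<emptyset>} under the true condition.\<close>
      proof (rule code_if_eq[OF ext_finite[OF \<Gamma>\<^sub>3], of "Var 0" zero "pair e0 p" "pair e1 a"])
        fix \<Delta> x assume \<Delta>: "\<Gamma>\<^sub>3 \<sqsubseteq> \<Delta>"
          and x0': "\<And>\<Theta> n. \<Delta> \<sqsubseteq> \<Theta> \<Longrightarrow> \<Theta> \<turnstile> inst n (Var 0 \<^bold>= zero) \<Longrightarrow> \<Theta> \<turnstile> app x n (pair e0 p)"
          and x1': "\<And>\<Theta> n. \<Delta> \<sqsubseteq> \<Theta> \<Longrightarrow> \<Theta> \<turnstile> Neg (inst n (Var 0 \<^bold>= zero)) \<Longrightarrow> \<Theta> \<turnstile> app x n (pair e1 a)"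
        have fin: "finite \<Delta>" using \<Delta> by (rule ext_finite)
        have x0: "\<Theta> \<turnstile> app x n (pair e0 p)" if "\<Delta> \<sqsubseteq> \<Theta>" "\<Theta> \<turnstile> n \<^bold>= zero" for \<Theta> n
          using x0'[of \<Theta> n] that by simp
        have x1: "\<Theta> \<turnstile> app x n (pair e1 a)" if "\<Delta> \<sqsubseteq> \<Theta>" "\<Theta> \<turnstile> Neg (n \<^bold>= zero)" for \<Theta> n
          using x1'[of \<Theta> n] that by simp
        have facts: "\<Theta> \<turnstile> PM a" "\<Theta> \<turnstile> PT a" "\<Theta> \<turnstile> PM b" "\<Theta> \<turnstile> Neg (PT b)" "\<Theta> \<turnstile> PM p"
            "\<Theta> \<turnstile> interp E foundation" "\<Theta> \<turnstile> app e0 n (pair zero b)" "\<Theta> \<turnstile> app e1 n (pair e0 a)"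
          if "\<Delta> \<sqsubseteq> \<Theta>" for \<Theta> n
          using that by (meson wk Ma Ta Mb Fb M F e0 e1 \<Gamma>\<^sub>1 \<Gamma>\<^sub>2 \<Gamma>\<^sub>3 \<Delta> ext_trans)+
        have n_cases: "\<Theta> \<turnstile> \<chi>" if \<Theta>: "\<Delta> \<sqsubseteq> \<Theta>"
          and "\<And>\<Omega>. \<Theta> \<sqsubseteq> \<Omega> \<Longrightarrow> \<Delta> \<sqsubseteq> \<Omega> \<Longrightarrow> \<Omega> \<turnstile> app x n (pair e0 p) \<Longrightarrow> \<Omega> \<turnstile> \<chi>"
          and "\<And>\<Omega>. \<Theta> \<sqsubseteq> \<Omega> \<Longrightarrow> \<Delta> \<sqsubseteq> \<Omega> \<Longrightarrow> \<Omega> \<turnstile> app x n (pair e1 a) \<Longrightarrow> \<Omega> \<turnstile> \<chi>" for \<Theta> \<chi> n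
          by (rule Or_ext[OF ext_finite[OF \<Theta>] eq_dec[OF ext_finite[OF \<Theta>], of n zero]])
            (meson that x0 x1 ext_trans)+
        have V0: "\<Delta> \<turnstile> PV e0"
        proof (rule PV_I[OF fin], rule vset_entryI)
          fix \<Theta> n assume \<Theta>: "\<Delta> \<sqsubseteq> \<Theta>"
          show "finite \<Theta>" using \<Theta> by (rule ext_finite)
          show "\<Theta> \<turnstile> app e0 n (pair zero b)" "\<Theta> \<turnstile> PM b" using facts[OF \<Theta>] by blast+
          show "\<Theta> \<turnstile> PT b \<^bold>\<longrightarrow> PV zero"
            using facts(4) \<Theta> ext_trans by (intro Imp_ext \<open>finite \<Theta>\<close>) (blast intro: NegD)
        qed
        have E0: "\<Delta> \<turnstile> rel2 E e0 e0"
        proof (rule rel2_refl[OF fin E V0])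
          fix \<Theta> c assume \<Theta>: "\<Delta> \<sqsubseteq> \<Theta>" and c: "\<Theta> \<turnstile> inEL c e0"
          from ext_finite[OF \<Theta>] c show "\<Theta> \<turnstile> rel2 E c c"
          proof (rule inEL_E)
            fix \<Omega> n v assume \<Omega>: "\<Theta> \<sqsubseteq> \<Omega>" and v: "\<Omega> \<turnstile> app e0 n v" "\<Omega> \<turnstile> PT (rgt v)" "\<Omega> \<turnstile> c \<^bold>= lft v"
            have \<Delta>\<Omega>: "\<Delta> \<sqsubseteq> \<Omega>" using \<Theta> \<Omega> by (rule ext_trans)
            show "\<Omega> \<turnstile> rel2 E c c"
              using inEL_pairD(2)[OF ext_finite[OF \<Omega>] v facts(7)[OF \<Delta>\<Omega>]] facts(4)[OF \<Delta>\<Omega>]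
              by (blast intro: NegD)
          qed
        qed
        have V1: "\<Delta> \<turnstile> PV e1"
        proof (rule PV_I[OF fin], rule vset_entryI)
          fix \<Theta> n assume \<Theta>: "\<Delta> \<sqsubseteq> \<Theta>"
          show "finite \<Theta>" using \<Theta> by (rule ext_finite)
          show "\<Theta> \<turnstile> app e1 n (pair e0 a)" "\<Theta> \<turnstile> PM a" using facts[OF \<Theta>] by blast+
          show "\<Theta> \<turnstile> PT a \<^bold>\<longrightarrow> PV e0"
            using wk[OF V0] \<Theta> ext_trans by (intro Imp_ext \<open>finite \<Theta>\<close>) blast
        qed
        have E1: "\<Delta> \<turnstile> rel2 E e1 e1"
        proof (rule rel2_refl[OF fin E V1])
          fix \<Theta> c assume \<Theta>: "\<Delta> \<sqsubseteq> \<Theta>" and c: "\<Theta> \<turnstile> inEL c e1"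
          from ext_finite[OF \<Theta>] c show "\<Theta> \<turnstile> rel2 E c c"
          proof (rule inEL_E)
            fix \<Omega> n v assume \<Omega>: "\<Theta> \<sqsubseteq> \<Omega>" and v: "\<Omega> \<turnstile> app e1 n v" "\<Omega> \<turnstile> PT (rgt v)" "\<Omega> \<turnstile> c \<^bold>= lft v"
            have \<Delta>\<Omega>: "\<Delta> \<sqsubseteq> \<Omega>" using \<Theta> \<Omega> by (rule ext_trans)
            have "\<Omega> \<turnstile> c \<^bold>= e0"
              using inEL_pairD(1)[OF ext_finite[OF \<Omega>] v facts(8)[OF \<Delta>\<Omega>]] .
            then show "\<Omega> \<turnstile> rel2 E c c"
              using eq_subst[OF eq_sym, of \<Omega> c e0 "rel2 E (Var 0) (Var 0)"] wk[OF E0 \<Delta>\<Omega>] by simp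
          qed
        qed
        have Vx: "\<Delta> \<turnstile> PV x"
        proof (rule PV_I[OF fin])
          fix \<Theta> n assume \<Theta>: "\<Delta> \<sqsubseteq> \<Theta>"
          show "\<Theta> \<turnstile> app_sat x n (PM (rgt (Var 0)) \<^bold>\<and> (PT (rgt (Var 0)) \<^bold>\<longrightarrow> PV (lft (Var 0))))"
          proof (rule n_cases[OF \<Theta>, of n])
            fix \<Omega> assume \<Omega>: "\<Delta> \<sqsubseteq> \<Omega>"
            have imp: "\<Omega> \<turnstile> PT c \<^bold>\<longrightarrow> PV d" if "\<Delta> \<turnstile> PV d" for c d
              using wk[OF that] \<Omega> ext_trans by (intro Imp_ext ext_finite[OF \<Omega>]) blast
            show "\<Omega> \<turnstile> app_sat x n (PM (rgt (Var 0)) \<^bold>\<and> (PT (rgt (Var 0)) \<^bold>\<longrightarrow> PV (lft (Var 0))))"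
              if "\<Omega> \<turnstile> app x n (pair e0 p)"
              using vset_entryI[OF ext_finite[OF \<Omega>] that facts(5)[OF \<Omega>] imp[OF V0]] .
            show "\<Omega> \<turnstile> app_sat x n (PM (rgt (Var 0)) \<^bold>\<and> (PT (rgt (Var 0)) \<^bold>\<longrightarrow> PV (lft (Var 0))))"
              if "\<Omega> \<turnstile> app x n (pair e1 a)"
              using vset_entryI[OF ext_finite[OF \<Omega>] that facts(1)[OF \<Omega>] imp[OF V1]] .
          qed
        qed
        \<comment> \<open>Entry 1 shows that the set is inhabited, whatever the status of p.\<close>
        have "\<Delta> \<turnstile> Neg (succ zero \<^bold>= zero)" by (simp add: ha HA.succ_nz)
        then have mem1: "\<Delta> \<turnstile> inEL e1 x"
          using inEL_I[OF fin x1[OF ext_refl[OF fin]] facts(2)[OF ext_refl[OF fin]]] by blast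
        show "\<Delta> \<turnstile> PT p \<^bold>\<or> Neg (PT p)"
        proof (rule foundationD[OF fin facts(6)[OF ext_refl[OF fin]] Vx mem1 V1 E1])
          fix \<Theta> y assume \<Theta>: "\<Delta> \<sqsubseteq> \<Theta>" and y: "\<Theta> \<turnstile> inEL y x"
            and disj: "\<And>\<Omega> z. \<Theta> \<sqsubseteq> \<Omega> \<Longrightarrow> \<Omega> \<turnstile> PV z \<Longrightarrow> \<Omega> \<turnstile> rel2 E z z \<Longrightarrow> \<Omega> \<turnstile> inEL z y \<Longrightarrow>
              \<Omega> \<turnstile> inEL z x \<Longrightarrow> \<Omega> \<turnstile> \<^bold>\<bottom>"
          from ext_finite[OF \<Theta>] y show "\<Theta> \<turnstile> PT p \<^bold>\<or> Neg (PT p)"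
          proof (rule inEL_E)
            \<comment> \<open>The index n under which the chosen element is listed decides. Index 0
              is listed only if p is true; at any other index the element is \<open>e1\<close>, and
              truth of p would make \<emptyset> a common element of \<open>e1\<close> and x.\<close>
            fix \<Omega> n v assume \<Omega>: "\<Theta> \<sqsubseteq> \<Omega>" and v: "\<Omega> \<turnstile> app x n v" "\<Omega> \<turnstile> PT (rgt v)" "\<Omega> \<turnstile> y \<^bold>= lft v"
            have \<Delta>\<Omega>: "\<Delta> \<sqsubseteq> \<Omega>" using \<Theta> \<Omega> by (rule ext_trans)
            then show "\<Omega> \<turnstile> PT p \<^bold>\<or> Neg (PT p)"
            proof (rule n_cases[of _ n])
              fix \<Sigma> assume \<Sigma>: "\<Omega> \<sqsubseteq> \<Sigma>" and "\<Sigma> \<turnstile> app x n (pair e0 p)"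
              then have "\<Sigma> \<turnstile> PT p"
                using inEL_pairD(2)[OF ext_finite[OF \<Sigma>]] wk[OF v(1) \<Sigma>] wk[OF v(2) \<Sigma>] wk[OF v(3) \<Sigma>]
                by blast
              then show "\<Sigma> \<turnstile> PT p \<^bold>\<or> Neg (PT p)" by (rule OrI1)
            next
              fix \<Sigma> assume \<Sigma>: "\<Omega> \<sqsubseteq> \<Sigma>" and "\<Sigma> \<turnstile> app x n (pair e1 a)"
              then have yeq: "\<Sigma> \<turnstile> y \<^bold>= e1"
                using inEL_pairD(1)[OF ext_finite[OF \<Sigma>]] wk[OF v(1) \<Sigma>] wk[OF v(2) \<Sigma>] wk[OF v(3) \<Sigma>]
                by blast
              have "\<Pi> \<turnstile> \<^bold>\<bottom>" if \<Pi>: "\<Sigma> \<sqsubseteq> \<Pi>" and T: "\<Pi> \<turnstile> PT p" for \<Pi>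
              proof (rule disj)
                show "\<Theta> \<sqsubseteq> \<Pi>" by (meson ext_trans \<Omega> \<Sigma> \<Pi>)
                have \<Delta>\<Pi>: "\<Delta> \<sqsubseteq> \<Pi>" by (meson ext_trans \<Delta>\<Omega> \<Sigma> \<Pi>)
                show "\<Pi> \<turnstile> PV e0" "\<Pi> \<turnstile> rel2 E e0 e0" using wk V0 E0 \<Delta>\<Pi> by blast+
                have "\<Pi> \<turnstile> inEL e0 e1"
                  using inEL_I[OF ext_finite[OF \<Pi>] facts(8)[OF \<Delta>\<Pi>] facts(2)[OF \<Delta>\<Pi>]] .
                then show "\<Pi> \<turnstile> inEL e0 y"
                  using eq_subst[OF eq_sym[OF wk[OF yeq \<Pi>]], of "inEL (lift e0) (Var 0)"] by simp
                show "\<Pi> \<turnstile> inEL e0 x"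
                  using inEL_I[OF ext_finite[OF \<Pi>] x0[OF \<Delta>\<Pi> eq_refl] T] .
              qed
              then show "\<Sigma> \<turnstile> PT p \<^bold>\<or> Neg (PT p)"
                using ext_finite[OF \<Sigma>] by (intro OrI2 Imp_ext)
            qed
          qed
        qed
      qed
    qed
  qed
qed

section \<open>The diagonal argument\<close>

text \<open>When the value 0 is not impossible, 1 is a safe answer: nn = 1 would rule out every
  computation ending with 0 and thereby make p true. In neither case is it known whether nn is
  defined.\<close>

lemma foundation_avoids_diagonal:
  assumes fin: "finite \<Gamma>" and E: "{} \<turnstile> ext_equality E" and F: "\<Gamma> \<turnstile> interp E foundation"
  shows "\<Gamma> \<turnstile> Ex (Neg (app (lift n) (lift n) (Var 0)))"
proof -
  \<comment> \<open>\<open>Var 0\<close> counts steps: the equation of s and t says that the run of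
    nn has halted with 0 after that many steps.\<close>
  define s where "s = Fn pr_run [Var 0, conf_tm (lift n) (lift n) zero]"
  define t where "t = halt_tm zero"
  have inst: "inst z (s \<^bold>= t) = (Fn pr_run [z, conf_tm n n zero] \<^bold>= halt_tm zero)" for z
    by (simp add: s_def t_def)
  show ?thesis
  proof (rule universal_condition[OF fin, of s t])
    fix \<Delta> p assume \<Delta>: "\<Gamma> \<sqsubseteq> \<Delta>" and M: "\<Delta> \<turnstile> PM p"
      and T1: "\<Delta> \<turnstile> PT p \<^bold>\<longrightarrow> All (Neg (s \<^bold>= t))" and T2: "\<Delta> \<turnstile> All (Neg (s \<^bold>= t)) \<^bold>\<longrightarrow> PT p"
    have fin: "finite \<Delta>" using \<Delta> by (rule ext_finite)
    from condition_dec[OF fin E wk[OF F \<Delta>] M]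
    show "\<Delta> \<turnstile> Ex (Neg (app (lift n) (lift n) (Var 0)))"
    proof (rule Or_ext[OF fin])
      fix \<Theta> assume \<Theta>: "\<Delta> \<sqsubseteq> \<Theta>" and "\<Theta> \<turnstile> PT p"
      then have no: "\<Theta> \<turnstile> All (Neg (s \<^bold>= t))" using ImpE wk[OF T1 \<Theta>] by blast
      have "\<Theta> \<turnstile> Neg (app n n zero)"
      proof (rule Imp_ext[OF ext_finite[OF \<Theta>]])
        fix \<Omega> assume \<Omega>: "\<Theta> \<sqsubseteq> \<Omega>" and zero: "\<Omega> \<turnstile> app n n zero"
        from ext_finite[OF \<Omega>] zero show "\<Omega> \<turnstile> \<^bold>\<bottom>"
        proof (rule appE)
          fix \<Sigma> z assume \<Sigma>: "\<Omega> \<sqsubseteq> \<Sigma>" and z: "\<Sigma> \<turnstile> Fn pr_run [z, conf_tm n n zero] \<^bold>= halt_tm zero"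
          have "\<Sigma> \<turnstile> Neg (inst z (s \<^bold>= t))"
            using AllE[OF wk[OF wk[OF no \<Omega>] \<Sigma>], of z] by simp
          then show "\<Sigma> \<turnstile> \<^bold>\<bottom>" using z unfolding inst by (rule ImpE)
        qed
      qed
      then show "\<Theta> \<turnstile> Ex (Neg (app (lift n) (lift n) (Var 0)))"
        by (intro ExI[of _ _ zero]) simp
    next
      fix \<Theta> assume \<Theta>: "\<Delta> \<sqsubseteq> \<Theta>" and F: "\<Theta> \<turnstile> Neg (PT p)"
      have "\<Theta> \<turnstile> Neg (app n n (succ zero))"
      proof (rule Imp_ext[OF ext_finite[OF \<Theta>]])
        fix \<Omega> assume \<Omega>: "\<Theta> \<sqsubseteq> \<Omega>" and one: "\<Omega> \<turnstile> app n n (succ zero)"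
        have "\<Sigma> \<turnstile> \<^bold>\<bottom>" if \<Sigma>: "\<Omega> \<sqsubseteq> \<Sigma>" and "\<Sigma> \<turnstile> inst z (s \<^bold>= t)" for \<Sigma> z
          using app_functional[OF ext_finite[OF \<Sigma>] wk[OF one \<Sigma>] appI[OF that(2)[unfolded inst]]]
          by (rule eq_succ_zeroD)
        then have "\<Omega> \<turnstile> All (Neg (s \<^bold>= t))"
          using ext_finite[OF \<Omega>] by (auto intro!: All_terms Imp_ext)
        then have "\<Omega> \<turnstile> PT p" using wk[OF T2 ext_trans[OF \<Theta> \<Omega>]] by (blast intro: ImpE)
        then show "\<Omega> \<turnstile> \<^bold>\<bottom>" by (rule ImpE[OF wk[OF F \<Omega>]])
      qed
      then show "\<Theta> \<turnstile> Ex (Neg (app (lift n) (lift n) (Var 0)))"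
        by (intro ExI[of _ _ "succ zero"]) simp
    qed
  qed
qed

lemma not_foundation:
  assumes E: "{} \<turnstile> ext_equality E"
  shows "{} \<turnstile> Neg (interp E foundation)"
proof (rule Imp_ext)
  fix \<Gamma> assume \<Gamma>: "{} \<sqsubseteq> \<Gamma>" and F: "\<Gamma> \<turnstile> interp E foundation"
  have fin: "finite \<Gamma>" using \<Gamma> by (rule ext_finite)
  show "\<Gamma> \<turnstile> \<^bold>\<bottom>"
  proof (rule ECT_total[OF fin, of "Neg (app (Var 1) (Var 1) (Var 0))"])
    fix n show "\<Gamma> \<turnstile> inst n (Ex (Neg (app (Var 1) (Var 1) (Var 0))))"
      using foundation_avoids_diagonal[OF fin E F, of n] by simp
  next
    fix \<Delta> e assume \<Delta>: "\<Gamma> \<sqsubseteq> \<Delta>"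
      and "\<And>\<Theta> n. \<Delta> \<sqsubseteq> \<Theta> \<Longrightarrow> \<Theta> \<turnstile> app_sat e n (sb (up (case_nat n Var)) (Neg (app (Var 1) (Var 1) (Var 0))))"
    \<comment> \<open>The partial-term reading of ee carries both a value u and the refutation of
      \<open>app e e u\<close>.\<close>
    then have "\<Delta> \<turnstile> app_sat e e (Neg (app (lift e) (lift e) (Var 0)))"
      using ext_refl[OF ext_finite[OF \<Delta>]] by fastforce
    then show "\<Delta> \<turnstile> \<^bold>\<bottom>"
      by (rule app_satE[OF ext_finite[OF \<Delta>]]) (auto intro: ImpE)
  qed
qed simp

end

theorem theorem19:
  fixes \<xi> :: prfun and E :: fm
  assumes "\<And>a b c d. psem \<xi> [a, b] = psem \<xi> [c, d] \<Longrightarrow> a = c \<and> b = d"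
    and "proves (VMT \<xi>) {} (ext_equality E)"
  shows "false_in_vsets \<xi> E foundation"
  using vmt.not_foundation[OF assms(2)] by (simp add: false_in_vsets_def)

end
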